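(* Let $0<c<1/2$. Consider the hypothesis testing problem, with parameters $d,\epsilon,\eta$, of distinguishing the null distribution $D_0$ from the family $\{E_{\mathbf v}\}_{\mathbf v\in S}$ with uniform prior $\mu$ on $S$, defined in the context. There are constants $a,b>0$ such that for every $d\in\mathbb Z_+$ larger than an absolute constant, every $n\le (a d)^{1/2-c}/(\epsilon^2(1-2\eta))$ and every even integer $k<d^{c/4}$, $$\Big\|\mathbf E_{\mathbf v\sim\mu}\Big[\big(\bar E_{\mathbf v}^{\otimes n}\big)^{\le\infty,\,bk}\Big]-1\Big\|_{D_0^{\otimes n}}^2\le 1 .$$
   Context: Fix $\epsilon\in(0,1/2)$, $\eta\in(0,1/2)$. Let $\mathcal U_d$ be the uniform distribution on $\{\pm1\}^d$, with pmf $\mathcal U_d(\mathbf x)=2^{-d}$. For $\mathbf v\in\{\pm1\}^d$ let $f_{\mathbf v}(\mathbf x)=\mathbf 1\{\mathbf v\cdot\mathbf x-t\ge0\}$, where $t\in\mathbb R$ is chosen so that $\Pr_{\mathbf x\sim\mathcal U_d}[f_{\mathbf v}(\mathbf x)>0]=2\epsilon$. Define the distributions $A_{\mathbf v},B_{\mathbf v}$ on $\{\pm1\}^d$ by $$A_{\mathbf v}(\mathbf x)=\frac{\eta+(1-2\eta)f_{\mathbf v}(\mathbf x)}{\eta+(1-2\eta)\mathbf E[f_{\mathbf v}]}\,\mathcal U_d(\mathbf x),\qquad B_{\mathbf v}(\mathbf x)=\frac{1-\eta-(1-2\eta)f_{\mathbf v}(\mathbf x)}{1-\eta-(1-2\eta)\mathbf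 E[f_{\mathbf v}]}\,\mathcal U_d(\mathbf x).$$ $D_0$ is the product distribution of $(\mathbf x,y)\in\{\pm1\}^d\times\{0,1\}$ with $\mathbf x\sim\mathcal U_d$ and $y$ independent of $\mathbf x$ with $\Pr[y=1]=\eta+2(1-2\eta)\epsilon$. $E_{\mathbf v}$ is the distribution of $(\mathbf x,y)$ with the same marginal of $y$, and with $\mathbf x\mid y=1$ distributed as $A_{\mathbf v}$ and $\mathbf x\mid y=0$ as $B_{\mathbf v}$ (equivalently, $\mathbf x\sim\mathcal U_d$ and $y=f_{\mathbf v}(\mathbf x)$ with probability $1-\eta$, $y=1-f_{\mathbf v}(\mathbf x)$ otherwise). $S\subseteq\{\pm1\}^d$ is a set of $2^{\Omega(d^c)}$ vectors with $|\mathbf v\cdot\mathbf u|<d^{1/2+c}$ for all distinct $\mathbf v,\mathbf u\in S$ (such a set exists), and $\mu$ is uniform on $S$. In the testing problem one must distinguish $H_0$: samples come from $D_0$, from $H_1$: $\mathbf v\sim\mu$ is drawn and then samples come from $E_{\mathbf v}$. $\bar E_{\mathbf v}=E_{\mathbf v}/D_0$ is the likelihood ratio, and $\bar E_{\mathbf v}^{\otimes n}$ is its $n$-fold product, a function of $n$ samples. For a distribution $D$, $\langle f,g\rangle_D=\mathbf E_{X\sim D}[f(X)g(X)]$ and $\|f\|_D=\sqrt{\langle f,f\rangle_D}$. A polynomial $f(x_1,\dots,x_n)$ in $n$ samples has samplewise degree $(r,k)$ if each of its monomials uses at most $k$ different samples and has degree at most $r$ in each of them ($r=\infty$ means no restriction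 on the degree in each sample). $f^{\le r,k}$ denotes the orthogonal projection of $f$, in $L^2(D_0^{\otimes n})$, onto the space of polynomials of samplewise degree $(r,k)$. *)

theory Defs
  imports "HOL-Probability.Probability"
begin

text \<open>
  Vectors of the cube are functions \<^typ>\<open>nat \<Rightarrow> real\<close> that are extensional on
  \<^term>\<open>{..<d}\<close>; a labelled sample is a pair \<open>(x, y)\<close> with \<open>y\<close> equal to \<open>0\<close> or \<open>1\<close>.
\<close>

definition cube :: "nat \<Rightarrow> (nat \<Rightarrow> real) set" where
  "cube d = {..<d} \<rightarrow>\<^sub>E {-1, 1}"

definition dotp :: "nat \<Rightarrow> (nat \<Rightarrow> real) \<Rightarrow> (nat \<Rightarrow> real) \<Rightarrow> real" where
  "dotp d v x = (\<Sum>i<d. v i * x i)"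

definition unif :: "nat \<Rightarrow> (nat \<Rightarrow> real) pmf" where
  "unif d = pmf_of_set (cube d)"

definition halfspace :: "nat \<Rightarrow> real \<Rightarrow> (nat \<Rightarrow> real) \<Rightarrow> (nat \<Rightarrow> real) \<Rightarrow> real" where
  "halfspace d t v x = (if dotp d v x - t \<ge> 0 then 1 else 0)"

definition A_mass :: "nat \<Rightarrow> real \<Rightarrow> real \<Rightarrow> (nat \<Rightarrow> real) \<Rightarrow> (nat \<Rightarrow> real) \<Rightarrow> real" where
  "A_mass d \<eta> t v x =
     (\<eta> + (1 - 2 * \<eta>) * halfspace d t v x) /
     (\<eta> + (1 - 2 * \<eta>) * measure_pmf.expectation (unif d) (halfspace d t v)) * pmf (unif d) x"

definition B_mass :: "nat \<Rightarrow> real \<Rightarrow> real \<Rightarrow> (nat \<Rightarrow> real) \<Rightarrow> (nat \<Rightarrow> real) \<Rightarrow> real" where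
  "B_mass d \<eta> t v x =
     (1 - \<eta> - (1 - 2 * \<eta>) * halfspace d t v x) /
     (1 - \<eta> - (1 - 2 * \<eta>) * measure_pmf.expectation (unif d) (halfspace d t v)) * pmf (unif d) x"

text \<open>
  For \<open>0 < \<eta> < 1/2\<close> the two mass functions are nonnegative with total mass one, so that
  \<^const>\<open>embed_pmf\<close> does what is intended: see \<open>pmf_A_dist\<close> and \<open>pmf_B_dist\<close> below.
\<close>

definition A_dist :: "nat \<Rightarrow> real \<Rightarrow> real \<Rightarrow> (nat \<Rightarrow> real) \<Rightarrow> (nat \<Rightarrow> real) pmf" where
  "A_dist d \<eta> t v = embed_pmf (A_mass d \<eta> t v)"

definition B_dist :: "nat \<Rightarrow> real \<Rightarrow> real \<Rightarrow> (nat \<Rightarrow> real) \<Rightarrow> (nat \<Rightarrow> real) pmf" where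
  "B_dist d \<eta> t v = embed_pmf (B_mass d \<eta> t v)"

definition label_dist :: "real \<Rightarrow> real \<Rightarrow> real pmf" where
  "label_dist \<epsilon> \<eta> = map_pmf of_bool (bernoulli_pmf (\<eta> + 2 * (1 - 2 * \<eta>) * \<epsilon>))"

definition D0 :: "nat \<Rightarrow> real \<Rightarrow> real \<Rightarrow> ((nat \<Rightarrow> real) \<times> real) pmf" where
  "D0 d \<epsilon> \<eta> = pair_pmf (unif d) (label_dist \<epsilon> \<eta>)"

definition E_dist ::
  "nat \<Rightarrow> real \<Rightarrow> real \<Rightarrow> real \<Rightarrow> (nat \<Rightarrow> real) \<Rightarrow> ((nat \<Rightarrow> real) \<times> real) pmf" where
  "E_dist d \<epsilon> \<eta> t v = bind_pmf (label_dist \<epsilon> \<eta>)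
     (\<lambda>y. map_pmf (\<lambda>x. (x, y)) (if y = 1 then A_dist d \<eta> t v else B_dist d \<eta> t v))"

definition likelihood_ratio :: "'a pmf \<Rightarrow> 'a pmf \<Rightarrow> 'a \<Rightarrow> real" where
  "likelihood_ratio P Q z = pmf P z / pmf Q z"

text \<open>An \<open>n\<close>-tuple of samples is a function on \<^term>\<open>{..<n}\<close>.\<close>

definition iid_dist :: "nat \<Rightarrow> 'a pmf \<Rightarrow> (nat \<Rightarrow> 'a) pmf" where
  "iid_dist n P = Pi_pmf {..<n} undefined (\<lambda>_. P)"

definition tensor_power :: "nat \<Rightarrow> ('a \<Rightarrow> real) \<Rightarrow> (nat \<Rightarrow> 'a) \<Rightarrow> real" where
  "tensor_power n f X = (\<Prod>i<n. f (X i))"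

definition ip :: "'a pmf \<Rightarrow> ('a \<Rightarrow> real) \<Rightarrow> ('a \<Rightarrow> real) \<Rightarrow> real" where
  "ip P f g = measure_pmf.expectation P (\<lambda>z. f z * g z)"

definition L2norm :: "'a pmf \<Rightarrow> ('a \<Rightarrow> real) \<Rightarrow> real" where
  "L2norm P f = sqrt (ip P f f)"

text \<open>
  A monomial in one sample \<open>(x, y)\<close> has an exponent for each \<open>x\<^sub>j\<close> and one for \<open>y\<close>; a
  monomial in \<open>n\<close> samples is given by a family of such exponents.
\<close>

type_synonym sample_exponent = "(nat \<Rightarrow> nat) \<times> nat"

definition sample_degree :: "nat \<Rightarrow> sample_exponent \<Rightarrow> nat" where
  "sample_degree d e = (\<Sum>j<d. fst e j) + snd e"

definition sample_monomial :: "nat \<Rightarrow> sample_exponent \<Rightarrow> (nat \<Rightarrow> real) \<times> real \<Rightarrow> real" where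
  "sample_monomial d e z = (\<Prod>j<d. fst z j ^ fst e j) * snd z ^ snd e"

definition samples_monomial ::
  "nat \<Rightarrow> nat \<Rightarrow> (nat \<Rightarrow> sample_exponent) \<Rightarrow> (nat \<Rightarrow> (nat \<Rightarrow> real) \<times> real) \<Rightarrow> real" where
  "samples_monomial d n e X = (\<Prod>i<n. sample_monomial d (e i) (X i))"

text \<open>The bound \<open>k\<close> on the number of samples used is real, since it need not be an integer.\<close>

definition samplewise_exponents ::
  "nat \<Rightarrow> nat \<Rightarrow> enat \<Rightarrow> real \<Rightarrow> (nat \<Rightarrow> sample_exponent) set" where
  "samplewise_exponents d n r k =
     {e. real (card {i \<in> {..<n}. sample_degree d (e i) \<noteq> 0}) \<le> k \<and>
         (\<forall>i<n. enat (sample_degree d (e i)) \<le> r)}"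

definition samplewise_polys ::
  "nat \<Rightarrow> nat \<Rightarrow> enat \<Rightarrow> real \<Rightarrow> ((nat \<Rightarrow> (nat \<Rightarrow> real) \<times> real) \<Rightarrow> real) set" where
  "samplewise_polys d n r k =
     {(\<lambda>X. \<Sum>e\<in>F. a e * samples_monomial d n e X) | F a.
        finite F \<and> F \<subseteq> samplewise_exponents d n r k}"

text \<open>
  Orthogonal projection onto a linear space \<open>V\<close> of functions. As an element of \<open>V\<close> it is
  only determined up to equality on the support of \<open>P\<close> (on the cube different polynomials
  define the same function), hence the choice operator; inner products and norms with
  respect to \<open>P\<close> do not depend on the choice.
\<close>

definition orth_proj :: "'a pmf \<Rightarrow> ('a \<Rightarrow> real) set \<Rightarrow> ('a \<Rightarrow> real) \<Rightarrow> ('a \<Rightarrow> real)" where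
  "orth_proj P V f = (SOME p. p \<in> V \<and> (\<forall>q\<in>V. ip P (\<lambda>z. f z - p z) q = 0))"

definition samplewise_proj ::
  "nat \<Rightarrow> nat \<Rightarrow> ((nat \<Rightarrow> real) \<times> real) pmf \<Rightarrow> enat \<Rightarrow> real \<Rightarrow>
   ((nat \<Rightarrow> (nat \<Rightarrow> real) \<times> real) \<Rightarrow> real) \<Rightarrow> (nat \<Rightarrow> (nat \<Rightarrow> real) \<times> real) \<Rightarrow> real" where
  "samplewise_proj d n P r k f = orth_proj (iid_dist n P) (samplewise_polys d n r k) f"

lemma finite_cube: "finite (cube d)"
  unfolding cube_def by (intro finite_PiE) auto

lemma cube_nonempty: "cube d \<noteq> {}"
  unfolding cube_def by (simp add: PiE_eq_empty_iff)

lemma card_cube: "card (cube d) = 2 ^ d"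
  unfolding cube_def by (simp add: card_PiE numeral_2_eq_2)

lemma pmf_unif: "x \<in> cube d \<Longrightarrow> pmf (unif d) x = 1 / 2 ^ d"
  by (simp add: unif_def finite_cube cube_nonempty card_cube)

lemma expectation_halfspace_bounds:
  "0 \<le> measure_pmf.expectation (unif d) (halfspace d t v)"
  "measure_pmf.expectation (unif d) (halfspace d t v) \<le> 1"
  by (auto simp: halfspace_def intro!: integral_nonneg measure_pmf.integral_le_const
      measure_pmf.integrable_const_bound[where B = 1])

lemma pmf_embed_reweighted:
  fixes g :: "'a \<Rightarrow> real" and p :: "'a pmf"
  assumes "\<And>x. g x \<ge> 0" and "integrable (measure_pmf p) g"
    and "measure_pmf.expectation p g = 1"
  shows "pmf (embed_pmf (\<lambda>x. g x * pmf p x)) x = g x * pmf p x"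
proof (rule pmf_embed_pmf)
  have "(\<integral>\<^sup>+ x. ennreal (g x * pmf p x) \<partial>count_space UNIV) = (\<integral>\<^sup>+ x. ennreal (g x) \<partial>measure_pmf p)"
    using assms(1) by (simp add: nn_integral_measure_pmf ennreal_mult' mult.commute)
  also have "\<dots> = 1"
    using assms by (subst nn_integral_eq_integral) auto
  finally show "(\<integral>\<^sup>+ x. ennreal (g x * pmf p x) \<partial>count_space UNIV) = 1" .
qed (use assms(1) in auto)

lemma integrable_halfspace: "integrable (measure_pmf p) (halfspace d t v)"
  by (rule measure_pmf.integrable_const_bound[where B = 1]) (auto simp: halfspace_def)

lemma pmf_A_dist:
  assumes "0 < \<eta>" "\<eta> < 1/2"
  shows "pmf (A_dist d \<eta> t v) x = A_mass d \<eta> t v x"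
proof -
  define m where "m = measure_pmf.expectation (unif d) (halfspace d t v)"
  have "0 \<le> (1 - 2 * \<eta>) * m"
    using assms expectation_halfspace_bounds[of d t v] unfolding m_def by simp
  then have pos: "\<eta> + (1 - 2 * \<eta>) * m > 0"
    using assms by linarith
  note int = integrable_halfspace[of "unif d" d t v]
  have nonneg: "0 \<le> (\<eta> + (1 - 2 * \<eta>) * halfspace d t v x) / (\<eta> + (1 - 2 * \<eta>) * m)" for x
    using pos assms by (auto simp: halfspace_def)
  have int': "integrable (measure_pmf (unif d))
      (\<lambda>x. (\<eta> + (1 - 2 * \<eta>) * halfspace d t v x) / (\<eta> + (1 - 2 * \<eta>) * m))"
    using int by simp
  have mean: "measure_pmf.expectation (unif d)
      (\<lambda>x. (\<eta> + (1 - 2 * \<eta>) * halfspace d t v x) / (\<eta> + (1 - 2 * \<eta>) * m)) = 1"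
    using int pos by (simp add: m_def)
  show ?thesis
    unfolding A_dist_def A_mass_def m_def[symmetric]
    by (rule pmf_embed_reweighted[OF nonneg int' mean])
qed

lemma pmf_B_dist:
  assumes "0 < \<eta>" "\<eta> < 1/2"
  shows "pmf (B_dist d \<eta> t v) x = B_mass d \<eta> t v x"
proof -
  define m where "m = measure_pmf.expectation (unif d) (halfspace d t v)"
  have "(1 - 2 * \<eta>) * m \<le> 1 - 2 * \<eta>"
    using assms expectation_halfspace_bounds[of d t v] unfolding m_def
    by (intro mult_left_le) auto
  then have pos: "1 - \<eta> - (1 - 2 * \<eta>) * m > 0"
    using assms by linarith
  note int = integrable_halfspace[of "unif d" d t v]
  have nonneg: "0 \<le> (1 - \<eta> - (1 - 2 * \<eta>) * halfspace d t v x) / (1 - \<eta> - (1 - 2 * \<eta>) * m)" for x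
    using pos assms by (auto simp: halfspace_def)
  have int': "integrable (measure_pmf (unif d))
      (\<lambda>x. (1 - \<eta> - (1 - 2 * \<eta>) * halfspace d t v x) / (1 - \<eta> - (1 - 2 * \<eta>) * m))"
    using int by simp
  have mean: "measure_pmf.expectation (unif d)
      (\<lambda>x. (1 - \<eta> - (1 - 2 * \<eta>) * halfspace d t v x) / (1 - \<eta> - (1 - 2 * \<eta>) * m)) = 1"
    using int pos by (simp add: m_def)
  show ?thesis
    unfolding B_dist_def B_mass_def m_def[symmetric]
    by (rule pmf_embed_reweighted[OF nonneg int' mean])
qed

end

theory Submission imports Defs "HOL-Real_Asymp.Real_Asymp" begin

text \<open>
  Write the likelihood ratio as \<open>1 + h\<^sub>v\<close>, where \<open>h\<^sub>v\<close> has mean zero under \<open>D\<^sub>0\<close>. Every function on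
  the finite sample space is a polynomial, so the projection of the \<open>n\<close>-fold product keeps exactly
  the terms \<open>\<Prod>i\<in>T. h\<^sub>v (X i)\<close> with \<open>card T \<le> b k\<close>; these are orthogonal for different \<open>T\<close>, and the
  squared norm is the average over \<open>u, v\<close> of \<open>\<Sum>T. \<lambda>\<^sub>u\<^sub>v ^ card T\<close> with \<open>\<lambda>\<^sub>u\<^sub>v = \<langle>h\<^sub>u, h\<^sub>v\<rangle>\<close>, over nonempty \<open>T\<close>.

  Up to a factor, \<open>\<lambda>\<^sub>u\<^sub>v\<close> is the covariance of two halfspaces, which is bounded without Fourier
  analysis. Let \<open>F b\<close> be the probability that both \<open>v \<cdot> x\<close> and \<open>u \<cdot> x\<close> are below the threshold when
  \<open>v, u\<close> differ in \<open>b\<close> coordinates, and let \<open>\<delta>\<close> be that probability for one vector. Changing one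
  coordinate of \<open>u\<close> changes \<open>F\<close> by half the probability that two independent walks, of lengths adding
  up to \<open>d - 1\<close>, end at prescribed points; near \<open>b = d/2\<close> this is \<open>O(\<delta>/d)\<close>, including when \<open>\<delta>\<close> is
  tiny. Since \<open>\<delta>\<^sup>2\<close> is the average of \<open>F\<close> over a uniform \<open>u\<close>, the covariance is
  \<open>O(\<delta> (\<bar>v \<cdot> u\<bar> + \<surd>d) / d)\<close>.

  Off the diagonal \<open>n \<lambda>\<^sub>u\<^sub>v \<le> 1/4\<close> if \<open>a\<close> is small. On the diagonal the sum is at most
  \<open>d powr (d powr (c/4) + 1)\<close>, which the weight \<open>1 / card S\<close> beats for large \<open>d\<close>; for the remaining \<open>d\<close>
  the constant \<open>b\<close> is chosen so small that \<open>b k < 1\<close> and the projection is constant.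
\<close>

section \<open>Random walks and the covariance of two halfspaces\<close>

definition binmass :: "nat \<Rightarrow> nat \<Rightarrow> real" where
  "binmass n p = real (n choose p) / 2 ^ n"

text \<open>Expectation of \<open>\<phi>\<close> at the endpoint of an \<open>n\<close>-step simple
  random walk from 0; \<open>p\<close> counts the upward steps.\<close>

definition walk_avg :: "nat \<Rightarrow> (real \<Rightarrow> real) \<Rightarrow> real" where
  "walk_avg n \<phi> = (\<Sum>p\<le>n. binmass n p * \<phi> (2 * real p - real n))"

lemma binmass_nonneg: "0 \<le> binmass n p"
  by (simp add: binmass_def)

lemma sum_binmass: "(\<Sum>p\<le>n. binmass n p) = 1"
proof -
  have "(\<Sum>p\<le>n. real (n choose p)) = 2 ^ n"
    using choose_row_sum[of n] by (metis of_nat_numeral of_nat_power of_nat_sum)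
  then show ?thesis
    by (simp add: binmass_def flip: sum_divide_distrib)
qed

text \<open>Passing from \<open>m\<close> to \<open>m + 1\<close> multiplies the central mass by
  \<open>(2m+1)/(2m+2)\<close>. Hence its square times \<open>2m + 1\<close> is nonincreasing,
  because \<open>(2m+1)(2m+3) \<le> (2m+2)^2\<close>, and it starts at 1.\<close>

lemma central_binmass_le: "binmass (2 * m) m \<le> 1 / sqrt (real (2 * m + 1))"
proof -
  have "(binmass (2 * m) m)\<^sup>2 * real (2 * m + 1) \<le> 1"
  proof (induction m)
    case 0
    show ?case by (simp add: binmass_def)
  next
    case (Suc m)
    have "real (Suc m) * real (Suc (Suc (2 * m)) choose Suc m)
        = real (Suc (Suc (2 * m))) * real (Suc (2 * m) choose m)"
      by (metis Suc_times_binomial_eq mult.commute of_nat_mult)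
    moreover have "real (Suc m) * real (Suc (2 * m) choose m)
        = real (Suc (2 * m)) * real (2 * m choose m)"
    proof -
      have "Suc (2 * m) choose m = Suc (2 * m) choose Suc m"
        by (metis Suc_diff_le add_diff_cancel_right' binomial_symmetric le_add2 le_SucI mult_2)
      then show ?thesis
        by (metis Suc_times_binomial_eq mult.commute of_nat_mult)
    qed
    ultimately have c: "real (2 * Suc m choose Suc m) * (real m + 1)
        = real (2 * m choose m) * (2 * (2 * real m + 1))"
      by (simp add: algebra_simps del: binomial_Suc_Suc)
    have "binmass (2 * Suc m) (Suc m) = (real (2 * Suc m choose Suc m) * (real m + 1)) / (2 ^ (2 * Suc m) * (real m + 1))"
      by (simp add: binmass_def del: binomial_Suc_Suc)
    also have "\<dots> = binmass (2 * m) m * ((2 * real m + 1) / (2 * real m + 2))"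
      unfolding c by (simp add: binmass_def divide_simps) (simp add: algebra_simps)
    finally have "binmass (2 * Suc m) (Suc m) = binmass (2 * m) m * ((2 * real m + 1) / (2 * real m + 2))" .
    then have "(binmass (2 * Suc m) (Suc m))\<^sup>2 * real (2 * Suc m + 1)
       = ((binmass (2 * m) m)\<^sup>2 * (2 * real m + 1)) * ((2 * real m + 1) * (2 * real m + 3) / (2 * real m + 2)\<^sup>2)"
      by (simp add: power_mult_distrib power_divide power2_eq_square algebra_simps)
    also have "\<dots> \<le> 1 * 1"
    proof (rule mult_mono)
      have "(2 * real m + 1) * (2 * real m + 3) \<le> (2 * real m + 2)\<^sup>2"
        by (simp add: power2_eq_square algebra_simps)
      then show "(2 * real m + 1) * (2 * real m + 3) / (2 * real m + 2)\<^sup>2 \<le> 1"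
        by (simp add: divide_le_eq_1)
    qed (use Suc in \<open>auto simp: add.commute\<close>)
    finally show ?case by simp
  qed
  then have "sqrt ((binmass (2 * m) m)\<^sup>2 * real (2 * m + 1)) \<le> sqrt 1"
    by (simp only: real_sqrt_le_iff)
  then have "binmass (2 * m) m * sqrt (real (2 * m + 1)) \<le> 1"
    by (simp add: real_sqrt_mult binmass_nonneg)
  then show ?thesis
    by (simp add: field_simps)
qed

lemma binmass_le: "binmass n p \<le> 1 / sqrt (real (n + 1))"
proof -
  have "binmass n p \<le> binmass n (n div 2)"
    by (simp add: binmass_def binomial_maximum divide_right_mono)
  also have "\<dots> \<le> 1 / sqrt (real (n + 1))"
  proof (cases "even n")
    case True
    then show ?thesis using central_binmass_le[of "n div 2"] by simp
  next
    case False
    then obtain m where n: "n = 2 * m + 1" by (elim oddE)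
    \<comment> \<open>For odd \<open>n\<close> the two middle coefficients agree, so by Pascal's
      rule the central mass equals that of length \<open>n + 1\<close>, which is even.\<close>
    have "Suc (2 * m) choose m = Suc (2 * m) choose Suc m"
      by (metis Suc_diff_le add_diff_cancel_right' binomial_symmetric le_add2 le_SucI mult_2)
    then have "binmass n (n div 2) = binmass (2 * Suc m) (Suc m)"
      by (simp add: n binmass_def field_simps)
    also have "\<dots> \<le> 1 / sqrt (real (2 * Suc m + 1))"
      by (rule central_binmass_le)
    also have "\<dots> \<le> 1 / sqrt (real (n + 1))"
      by (intro divide_left_mono) (auto simp: n)
    finally show ?thesis .
  qed
  finally show ?thesis .
qed

text \<open>The reflection \<open>q \<mapsto> n - q\<close> gives the lower and the upper half the
  same mass, and together they cover everything.\<close>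

lemma sum_binmass_lower_half: "(\<Sum>q | 2 * q \<le> n. binmass n q) \<ge> 1 / 2"
proof -
  have fin: "finite {q. 2 * q \<le> n}"
    by (rule finite_subset[of _ "{..n}"]) auto
  have "(\<Sum>q | 2 * q \<le> n. binmass n q) = (\<Sum>q | q \<le> n \<and> n \<le> 2 * q. binmass n q)"
    by (rule sum.reindex_bij_witness[where i = "\<lambda>q. n - q" and j = "\<lambda>q. n - q"])
       (auto simp: binmass_def binomial_symmetric[symmetric])
  moreover have "1 \<le> (\<Sum>q | 2 * q \<le> n. binmass n q) + (\<Sum>q | q \<le> n \<and> n \<le> 2 * q. binmass n q)"
  proof -
    have "1 = (\<Sum>q\<in>{q. 2 * q \<le> n} \<union> {q. q \<le> n \<and> n \<le> 2 * q}. binmass n q)"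
      unfolding sum_binmass[of n, symmetric] by (rule sum.cong) auto
    also have "\<dots> \<le> (\<Sum>q | 2 * q \<le> n. binmass n q) + (\<Sum>q | q \<le> n \<and> n \<le> 2 * q. binmass n q)"
      using fin by (subst sum.union_inter[symmetric]) (auto intro!: sum_nonneg simp: binmass_nonneg)
    finally show ?thesis .
  qed
  ultimately show ?thesis by simp
qed

text \<open>Going from \<open>q \<le> e\<close> down to \<open>q + j \<le> e\<close> loses at most
  \<open>j\<close> indices, each weighing at most the central mass. Truncated subtraction in
  \<open>e + 1 - j\<close> only makes the lost interval shorter.\<close>

lemma binmass_tail_ge:
  "(\<Sum>q | q + j \<le> e. binmass (2 * e) q) \<ge> 1 / 2 - real j * binmass (2 * e) e"
proof -
  have "1 / 2 \<le> (\<Sum>q | q \<le> e. binmass (2 * e) q)"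
    using sum_binmass_lower_half[of "2 * e"] by simp
  also have "\<dots> \<le> (\<Sum>q\<in>{q. q + j \<le> e} \<union> {e + 1 - j..e}. binmass (2 * e) q)"
    by (rule sum_mono2) (auto simp: binmass_nonneg intro: finite_subset[of _ "{..e}"])
  also have "\<dots> \<le> (\<Sum>q | q + j \<le> e. binmass (2 * e) q) + (\<Sum>q\<in>{e + 1 - j..e}. binmass (2 * e) q)"
    by (subst sum.union_inter[symmetric])
       (auto intro!: sum_nonneg simp: binmass_nonneg intro: finite_subset[of _ "{..e}"])
  also have "(\<Sum>q\<in>{e + 1 - j..e}. binmass (2 * e) q) \<le> real (card {e + 1 - j..e}) * binmass (2 * e) e"
    using binomial_maximum[of "2 * e"]
    by (intro sum_bounded_above) (auto simp: binmass_def divide_right_mono)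
  also have "\<dots> \<le> real j * binmass (2 * e) e"
    by (intro mult_right_mono) (auto simp: binmass_nonneg)
  finally show ?thesis by simp
qed

text \<open>A point probability of the pair \<open>(p, q)\<close> is \<open>O(1/K)\<close> times the
  tail through that point. This relative bound is what keeps the covariance estimate proportional to
  \<delta> even when \<delta> is tiny.\<close>

lemma binmass_product_le_tail:
  assumes K: "0 < K" "K \<le> real (a + 1)" "K \<le> real (2 * e + 1)" and p: "p' \<le> a"
  shows "binmass a p' * binmass (2 * e) e
    \<le> 16 / K * (\<Sum>p\<le>a. binmass a p * (\<Sum>q\<le>2 * e. binmass (2 * e) q * of_bool (p + q \<le> p' + e)))"
proof -
  define r where "r = binmass (2 * e) e"
  \<comment> \<open>\<open>J\<close> is about a quarter of the standard deviation scale
    \<open>1/r\<close>: \<open>J * r \<le> 1/4\<close> keeps the tail \<open>q + J \<le> e\<close>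
    at mass at least 1/4, while \<open>J + 1\<close> is still at least
    \<open>1/(4r)\<close>.\<close>
  define J where "J = nat \<lfloor>1 / (4 * r)\<rfloor>"
  define V where "V p = (\<Sum>q\<le>2 * e. binmass (2 * e) q * of_bool (p + q \<le> p' + e))" for p
  define W where "W = (\<Sum>p\<le>a. binmass a p * V p)"
  have r0: "r > 0" by (simp add: r_def binmass_def)
  have J1: "real J * r \<le> 1 / 4"
  proof -
    have "real J \<le> 1 / (4 * r)" using r0 by (simp add: J_def)
    then show ?thesis using r0 by (simp add: field_simps)
  qed
  have J2: "1 \<le> 4 * r * (real J + 1)"
  proof -
    have "1 / (4 * r) \<le> real J + 1" using r0 unfolding J_def by linarith
    then show ?thesis using r0 by (simp add: field_simps)
  qed
  have V0: "V p \<ge> 0" for p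
    unfolding V_def by (intro sum_nonneg) (auto simp: binmass_nonneg)
  have V_ge: "V p \<ge> 1 / 4" if "p \<le> p' + J" for p
  proof -
    have "real J * binmass (2 * e) e \<le> 1 / 4" using J1 by (simp add: r_def)
    then have "1 / 4 \<le> (\<Sum>q | q + J \<le> e. binmass (2 * e) q)"
      using binmass_tail_ge[of J e] by linarith
    also have "\<dots> = (\<Sum>q | q + J \<le> e. binmass (2 * e) q * of_bool (p + q \<le> p' + e))"
      using that by (intro sum.cong) auto
    also have "\<dots> \<le> V p"
      unfolding V_def by (rule sum_mono2) (auto simp: binmass_nonneg)
    finally show ?thesis .
  qed
  have rK: "r \<le> 1 / sqrt K"
  proof -
    have "r \<le> 1 / sqrt (real (2 * e + 1))" unfolding r_def by (rule binmass_le)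
    also have "\<dots> \<le> 1 / sqrt K" using K by (intro divide_left_mono) auto
    finally show ?thesis .
  qed
  have "binmass a p' * r \<le> 16 / K * W"
  \<comment> \<open>If \<open>p' + J\<close> is in the lower half, the binomial masses increase on
    \<open>{p'..p' + J}\<close>, so \<open>J + 1\<close> values of \<open>p\<close> each contribute
    at least \<open>binmass a p' / 4\<close> to \<open>W\<close>; with
    \<open>J + 1 \<ge> 1/(4r)\<close> this gives \<open>16 * r^2 * W\<close>.\<close>
  proof (cases "2 * (p' + J) \<le> a")
    case True
    have "(real J + 1) * (binmass a p' * (1 / 4)) = (\<Sum>p\<in>{p'..p' + J}. binmass a p' * (1 / 4))"
      by simp
    also have "\<dots> \<le> (\<Sum>p\<in>{p'..p' + J}. binmass a p * V p)"
      using True V_ge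
      by (intro sum_mono mult_mono) (auto simp: binmass_def divide_right_mono binomial_mono)
    also have "\<dots> \<le> W"
      unfolding W_def using True V0 by (intro sum_mono2) (auto simp: binmass_nonneg)
    finally have *: "(real J + 1) * binmass a p' \<le> 4 * W" by simp
    have "binmass a p' * r \<le> binmass a p' * r * (4 * r * (real J + 1))"
      using mult_left_mono[OF J2, of "binmass a p' * r"] r0 binmass_nonneg[of a p'] by simp
    also have "\<dots> = 4 * r\<^sup>2 * ((real J + 1) * binmass a p')"
      by (simp add: power2_eq_square)
    also have "\<dots> \<le> 4 * r\<^sup>2 * (4 * W)"
      using * by (intro mult_left_mono) auto
    also have "\<dots> \<le> 4 * (1 / sqrt K)\<^sup>2 * (4 * W)"
      using rK r0 * binmass_nonneg[of a p']
      by (intro mult_right_mono mult_left_mono power_mono) (auto simp: W_def intro!: sum_nonneg mult_nonneg_nonneg V0 binmass_nonneg)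
    also have "\<dots> = 16 / K * W" using K by (simp add: power_divide)
    finally show ?thesis .
  next
    case False
    \<comment> \<open>Here the whole lower half of the \<open>p\<close> lies below
      \<open>p' + J\<close>, so the tail is at least 1/8, and the absolute bound \<open>1/K\<close>
      on the product suffices.\<close>
    have "1 / 2 * (1 / 4) \<le> (\<Sum>p | 2 * p \<le> a. binmass a p) * (1 / 4)"
      using sum_binmass_lower_half[of a] by (intro mult_right_mono) auto
    also have "\<dots> \<le> (\<Sum>p | 2 * p \<le> a. binmass a p * V p)"
      unfolding sum_distrib_right using False
      by (intro sum_mono mult_left_mono V_ge) (auto simp: binmass_nonneg)
    also have "\<dots> \<le> W"
      unfolding W_def using V0 by (intro sum_mono2) (auto simp: binmass_nonneg)
    finally have W: "1 / 8 \<le> W" by simp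
    have "binmass a p' \<le> 1 / sqrt (real (a + 1))" by (rule binmass_le)
    also have "\<dots> \<le> 1 / sqrt K" using K by (intro divide_left_mono) auto
    finally have "binmass a p' * r \<le> 1 / sqrt K * (1 / sqrt K)"
      using rK r0 K by (intro mult_mono) auto
    also have "\<dots> = 1 / K" using K by simp
    also have "\<dots> \<le> 16 / K * W" using K W by (simp add: field_simps)
    finally show ?thesis .
  qed
  then show ?thesis by (simp add: r_def W_def V_def)
qed

section \<open>Expectations over simple random walks\<close>

lemma walk_avg_0 [simp]: "walk_avg 0 \<phi> = \<phi> 0"
  by (simp add: walk_avg_def binmass_def)

lemma walk_avg_Suc:
  "walk_avg (Suc n) \<phi> = (walk_avg n (\<lambda>x. \<phi> (x + 1)) + walk_avg n (\<lambda>x. \<phi> (x - 1))) / 2"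
proof -
  \<comment> \<open>The down-step sum is reindexed by one so that it is evaluated at the same points
    as the up-step sum and Pascal's rule can merge them; the extra index \<open>n + 1\<close> has
    mass 0.\<close>
  have 1: "(\<Sum>p\<le>n. binmass n p * \<phi> (2 * real p - real n - 1))
      = \<phi> (- 1 - real n) / 2 ^ n + (\<Sum>p\<le>n. binmass n (Suc p) * \<phi> (2 * real p - real n + 1))"
  proof -
    have "(\<Sum>p\<le>n. binmass n p * \<phi> (2 * real p - real n - 1))
       = (\<Sum>p\<le>Suc n. binmass n p * \<phi> (2 * real p - real n - 1))"
      by (simp add: binmass_def)
    also have "\<dots> = \<phi> (- 1 - real n) / 2 ^ n + (\<Sum>p\<le>n. binmass n (Suc p) * \<phi> (2 * real p - real n + 1))"
      by (subst sum.atMost_Suc_shift) (simp add: binmass_def algebra_simps minus_diff_commute)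
    finally show ?thesis .
  qed
  have "walk_avg (Suc n) \<phi>
      = \<phi> (- 1 - real n) / 2 ^ Suc n
        + (\<Sum>p\<le>n. binmass (Suc n) (Suc p) * \<phi> (2 * real p - real n + 1))"
    unfolding walk_avg_def by (subst sum.atMost_Suc_shift) (simp add: binmass_def algebra_simps)
  also have "(\<Sum>p\<le>n. binmass (Suc n) (Suc p) * \<phi> (2 * real p - real n + 1))
      = (\<Sum>p\<le>n. (binmass n p * \<phi> (2 * real p - real n + 1)
                + binmass n (Suc p) * \<phi> (2 * real p - real n + 1)) / 2)"
    by (intro sum.cong) (auto simp: binmass_def field_simps)
  also have "\<dots> = ((\<Sum>p\<le>n. binmass n p * \<phi> (2 * real p - real n + 1))
                + (\<Sum>p\<le>n. binmass n (Suc p) * \<phi> (2 * real p - real n + 1))) / 2"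
    by (simp add: sum.distrib flip: sum_divide_distrib)
  finally have "walk_avg (Suc n) \<phi> = ((\<phi> (- 1 - real n) / 2 ^ n
      + (\<Sum>p\<le>n. binmass n (Suc p) * \<phi> (2 * real p - real n + 1)))
      + (\<Sum>p\<le>n. binmass n p * \<phi> (2 * real p - real n + 1))) / 2"
    by (simp add: add_divide_distrib)
  then show ?thesis
    unfolding 1[symmetric] walk_avg_def by (simp add: add.commute)
qed

lemma walk_avg_mono: "(\<And>x. \<phi> x \<le> \<psi> x) \<Longrightarrow> walk_avg n \<phi> \<le> walk_avg n \<psi>"
  unfolding walk_avg_def by (intro sum_mono mult_left_mono) (auto simp: binmass_nonneg)

lemma walk_avg_const [simp]: "walk_avg n (\<lambda>_. c) = c"
  by (simp add: walk_avg_def sum_binmass flip: sum_distrib_right)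

lemma walk_avg_nonneg: "(\<And>x. 0 \<le> \<phi> x) \<Longrightarrow> 0 \<le> walk_avg n \<phi>"
  using walk_avg_mono[of "\<lambda>_. 0" \<phi> n] by simp

lemma walk_avg_add: "walk_avg n (\<lambda>x. \<phi> x + \<psi> x) = walk_avg n \<phi> + walk_avg n \<psi>"
  by (simp add: walk_avg_def distrib_left sum.distrib)

lemma walk_avg_diff: "walk_avg n (\<lambda>x. \<phi> x - \<psi> x) = walk_avg n \<phi> - walk_avg n \<psi>"
  by (simp add: walk_avg_def right_diff_distrib sum_subtractf)

lemma walk_avg_cmult: "walk_avg n (\<lambda>x. c * \<phi> x) = c * walk_avg n \<phi>"
  by (simp add: walk_avg_def sum_distrib_left mult_ac)

lemma walk_avg_divide: "walk_avg n (\<lambda>x. \<phi> x / c) = walk_avg n \<phi> / c"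
  by (simp add: walk_avg_def sum_divide_distrib)

lemma walk_avg_convolution:
  "walk_avg (a + b) \<phi> = walk_avg a (\<lambda>x. walk_avg b (\<lambda>y. \<phi> (x + y)))"
  by (induction b arbitrary: \<phi>)
     (simp_all add: walk_avg_Suc walk_avg_add walk_avg_divide add.assoc add_diff_eq)

text \<open>Second moment of the walk; the shift \<open>c\<close> is there for the induction, since
  a step turns \<open>c\<close> into \<open>c + 1\<close> and \<open>c - 1\<close>.\<close>

lemma walk_avg_square: "walk_avg n (\<lambda>x. (x + c)\<^sup>2) = real n + c\<^sup>2"
proof (induction n arbitrary: c)
  case (Suc n)
  have "(x + 1 + c)\<^sup>2 = (x + (1 + c))\<^sup>2" "(x - 1 + c)\<^sup>2 = (x + (c - 1))\<^sup>2" for x :: real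
    by (simp_all add: add_ac add_diff_eq)
  then show ?case
    by (simp add: walk_avg_Suc Suc) (simp add: power2_eq_square field_simps)
qed simp

text \<open>
  A uniform point of the cube, seen through two sign vectors that agree in \<open>a\<close> and differ in
  \<open>b\<close> coordinates, is \<open>(X + Y, X - Y)\<close> for independent simple random walks of lengths \<open>a\<close> and \<open>b\<close>.
\<close>

definition pair_walk_avg :: "nat \<Rightarrow> nat \<Rightarrow> (real \<Rightarrow> real \<Rightarrow> real) \<Rightarrow> real" where
  "pair_walk_avg a b h = walk_avg a (\<lambda>x. walk_avg b (\<lambda>y. h (x + y) (x - y)))"

lemma pair_walk_avg_Suc_agree:
  "pair_walk_avg (Suc a) b h =
     (pair_walk_avg a b (\<lambda>x y. h (x + 1) (y + 1)) + pair_walk_avg a b (\<lambda>x y. h (x - 1) (y - 1))) / 2"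
  by (simp add: pair_walk_avg_def walk_avg_Suc algebra_simps)

lemma pair_walk_avg_Suc_differ:
  "pair_walk_avg a (Suc b) h =
     (pair_walk_avg a b (\<lambda>x y. h (x + 1) (y - 1)) + pair_walk_avg a b (\<lambda>x y. h (x - 1) (y + 1))) / 2"
  by (simp add: pair_walk_avg_def walk_avg_Suc walk_avg_divide walk_avg_add algebra_simps)

section \<open>Averages over the cube as walk expectations\<close>

definition cube_avg :: "nat \<Rightarrow> ((nat \<Rightarrow> real) \<Rightarrow> real) \<Rightarrow> real" where
  "cube_avg d \<phi> = (\<Sum>x\<in>cube d. \<phi> x) / 2 ^ d"

lemma cube_avg_Suc:
  "cube_avg (Suc d) \<phi> = (cube_avg d (\<lambda>x. \<phi> (x(d := 1))) + cube_avg d (\<lambda>x. \<phi> (x(d := -1)))) / 2"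
proof -
  have "cube (Suc d) = (\<lambda>(y, g). g(d := y)) ` ({-1, 1} \<times> cube d)"
    unfolding cube_def lessThan_Suc by (rule PiE_insert_eq)
  moreover have "inj_on (\<lambda>(y, g). g(d := y)) ({-1, 1} \<times> cube d)"
    unfolding cube_def by (rule inj_combinator) simp
  ultimately have "(\<Sum>x\<in>cube (Suc d). \<phi> x) = (\<Sum>(y, g)\<in>{-1, 1} \<times> cube d. \<phi> (g(d := y)))"
    by (simp add: sum.reindex case_prod_unfold)
  also have "\<dots> = (\<Sum>x\<in>cube d. \<phi> (x(d := 1))) + (\<Sum>x\<in>cube d. \<phi> (x(d := -1)))"
    by (simp add: sum.cartesian_product[symmetric])
  finally show ?thesis by (simp add: cube_avg_def field_simps)
qed

lemma dotp_Suc_upd: "dotp (Suc d) v (x(d := s)) = dotp d v x + v d * s"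
  by (simp add: dotp_def)

text \<open>Splitting off the last coordinate of \<open>x\<close> adds equal signs to both inner
  products if \<open>v\<close> and \<open>u\<close> agree there and opposite signs otherwise. These
  are the two recursions of \<open>pair_walk_avg\<close>.\<close>

lemma cube_avg_two_dotps:
  assumes "\<And>i. i < d \<Longrightarrow> v i \<in> {-1, 1}" "\<And>i. i < d \<Longrightarrow> u i \<in> {-1, 1}"
  shows "cube_avg d (\<lambda>x. h (dotp d v x) (dotp d u x)) =
    pair_walk_avg (d - card {i. i < d \<and> v i \<noteq> u i}) (card {i. i < d \<and> v i \<noteq> u i}) h"
  using assms
proof (induction d arbitrary: h)
  case 0
  then show ?case by (simp add: cube_avg_def cube_def dotp_def pair_walk_avg_def)
next
  case (Suc d)
  define b where "b = card {i. i < d \<and> v i \<noteq> u i}"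
  have b: "b \<le> d"
    unfolding b_def using card_mono[of "{..<d}" "{i. i < d \<and> v i \<noteq> u i}"] by auto
  have IH: "cube_avg d (\<lambda>x. h' (dotp d v x) (dotp d u x)) = pair_walk_avg (d - b) b h'" for h'
    unfolding b_def by (rule Suc.IH) (use Suc.prems in auto)
  have vd: "v d = -1 \<or> v d = 1" "u d = -1 \<or> u d = 1" using Suc.prems[of d] by auto
  show ?case
  proof (cases "v d = u d")
    case True
    then have "{i. i < Suc d \<and> v i \<noteq> u i} = {i. i < d \<and> v i \<noteq> u i}"
      by (auto simp: less_Suc_eq)
    \<comment> \<open>A negative sign \<open>v d\<close> only swaps the two halves of the
      average.\<close>
    moreover have "cube_avg (Suc d) (\<lambda>x. h (dotp (Suc d) v x) (dotp (Suc d) u x))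
        = pair_walk_avg (Suc (d - b)) b h"
      using vd True unfolding cube_avg_Suc dotp_Suc_upd pair_walk_avg_Suc_agree IH[symmetric]
      by (elim disjE) simp_all
    ultimately show ?thesis
      using b by (simp only: b_def[symmetric] Suc_diff_le)
  next
    case False
    then have "{i. i < Suc d \<and> v i \<noteq> u i} = insert d {i. i < d \<and> v i \<noteq> u i}"
      by (auto simp: less_Suc_eq)
    then have "card {i. i < Suc d \<and> v i \<noteq> u i} = Suc b"
      by (simp add: b_def)
    moreover have "cube_avg (Suc d) (\<lambda>x. h (dotp (Suc d) v x) (dotp (Suc d) u x))
        = pair_walk_avg (d - b) (Suc b) h"
      using vd False unfolding cube_avg_Suc dotp_Suc_upd pair_walk_avg_Suc_differ IH[symmetric]
      by (elim disjE) simp_all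
    ultimately show ?thesis
      by (simp only: diff_Suc_Suc)
  qed
qed

lemma cube_avg_dotp:
  assumes "v \<in> cube d"
  shows "cube_avg d (\<lambda>x. \<phi> (dotp d v x)) = walk_avg d \<phi>"
proof -
  have "v i \<in> {-1, 1}" if "i < d" for i using assms that by (auto simp: cube_def)
  from cube_avg_two_dotps[OF this this, where h = "\<lambda>x _. \<phi> x"] show ?thesis
    by (simp add: pair_walk_avg_def)
qed

lemma dotp_commute: "dotp d v u = dotp d u v"
  by (simp add: dotp_def mult.commute)

lemma dotp_eq_disagreements:
  assumes "v \<in> cube d" "u \<in> cube d"
  shows "dotp d v u = real d - 2 * real (card {i. i < d \<and> v i \<noteq> u i})"
proof -
  have "dotp d v u = (\<Sum>i<d. 1 - 2 * of_bool (v i \<noteq> u i))"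
    unfolding dotp_def
  proof (rule sum.cong)
    fix i assume "i \<in> {..<d}"
    then have "v i = -1 \<or> v i = 1" "u i = -1 \<or> u i = 1"
      using assms by (auto simp: cube_def)
    then show "v i * u i = 1 - 2 * of_bool (v i \<noteq> u i)" by auto
  qed simp
  also have "\<dots> = real d - 2 * (\<Sum>i<d. of_bool (v i \<noteq> u i))"
    by (simp add: sum_subtractf sum_distrib_left)
  also have "(\<Sum>i<d. of_bool (v i \<noteq> u i) :: real) = real (card {i. i < d \<and> v i \<noteq> u i})"
    by (simp add: of_bool_def sum.If_cases lessThan_def Int_def)
  finally show ?thesis .
qed

section \<open>Dependence of the joint probability on the number of disagreements\<close>

definition both_below :: "real \<Rightarrow> real \<Rightarrow> real \<Rightarrow> real" where
  "both_below t x y = of_bool (x < t) * of_bool (y < t)"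

text \<open>Turning an agreeing coordinate into a differing one produces a mixed second difference
  of a product of indicators, hence half the probability that both endpoints fall into a window of
  length 2. At most one pair of walk positions does so, and \<open>binmass_product_le_tail\<close>
  compares its mass with the tail.\<close>

lemma pair_walk_step:
  fixes t :: real
  assumes d: "d = Suc (a + b)" and K: "0 < K" "K \<le> real (a + 1)" "K \<le> real (b + 1)"
  shows "pair_walk_avg (Suc a) b (both_below t) - pair_walk_avg a (Suc b) (both_below t)
    \<in> {0..16 / K * walk_avg d (\<lambda>x. of_bool (x < t))}"
proof -
  \<comment> \<open>The window on which the indicators of \<open>z - 1 < t\<close> and
    \<open>z + 1 < t\<close> differ; half-open, so it contains exactly one point of each class
    modulo 2.\<close>
  define I where "I = {t - 1..<t + 1}"
  define P where "P = pair_walk_avg a b (\<lambda>x y. of_bool (x \<in> I \<and> y \<in> I))"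
  define T where "T = walk_avg (a + b) (\<lambda>x. of_bool (x < t + 1))"
  have "pair_walk_avg (Suc a) b (both_below t) - pair_walk_avg a (Suc b) (both_below t)
     = pair_walk_avg a b (\<lambda>x y. (both_below t (x + 1) (y + 1) + both_below t (x - 1) (y - 1)
          - both_below t (x + 1) (y - 1) - both_below t (x - 1) (y + 1)) / 2)"
    unfolding pair_walk_avg_Suc_agree pair_walk_avg_Suc_differ
    unfolding pair_walk_avg_def walk_avg_divide walk_avg_diff walk_avg_add
    by (simp only: diff_divide_distrib diff_diff_eq add_divide_distrib)
  also have "(\<lambda>x y. (both_below t (x + 1) (y + 1) + both_below t (x - 1) (y - 1)
          - both_below t (x + 1) (y - 1) - both_below t (x - 1) (y + 1)) / 2)
      = (\<lambda>x y. of_bool (x \<in> I \<and> y \<in> I) / 2)"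
  proof (intro ext)
    fix x y
    have I: "of_bool (z - 1 < t) - of_bool (z + 1 < t) = (of_bool (z \<in> I) :: real)" for z
      by (auto simp: I_def of_bool_def)
    have "(both_below t (x + 1) (y + 1) + both_below t (x - 1) (y - 1)
          - both_below t (x + 1) (y - 1) - both_below t (x - 1) (y + 1)) / 2
       = (of_bool (x - 1 < t) - of_bool (x + 1 < t)) * (of_bool (y - 1 < t) - of_bool (y + 1 < t)) / 2"
      unfolding both_below_def by algebra
    then show "(both_below t (x + 1) (y + 1) + both_below t (x - 1) (y - 1)
          - both_below t (x + 1) (y - 1) - both_below t (x - 1) (y + 1)) / 2
       = of_bool (x \<in> I \<and> y \<in> I) / 2"
      unfolding I by (simp add: of_bool_conj)
  qed
  also have "pair_walk_avg a b \<dots> = P / 2"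
    by (simp add: pair_walk_avg_def walk_avg_divide P_def)
  finally have diff: "pair_walk_avg (Suc a) b (both_below t) - pair_walk_avg a (Suc b) (both_below t)
      = P / 2" .
  have P0: "0 \<le> P"
    unfolding P_def pair_walk_avg_def by (intro walk_avg_nonneg) auto
  have T0: "0 \<le> T"
    unfolding T_def by (intro walk_avg_nonneg) auto
  \<comment> \<open>The walk of length \<open>d\<close> has one more step, which is downward with
    probability 1/2.\<close>
  have T: "T \<le> 2 * walk_avg d (\<lambda>x. of_bool (x < t))"
  proof -
    have "0 \<le> walk_avg (a + b) (\<lambda>x. of_bool (x + 1 < t))"
      by (intro walk_avg_nonneg) auto
    moreover have "T = walk_avg (a + b) (\<lambda>x. of_bool (x - 1 < t))"
      unfolding T_def by (simp add: diff_less_eq)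
    ultimately show ?thesis unfolding d walk_avg_Suc by simp
  qed
  have T_sum: "T = (\<Sum>p\<le>a. binmass a p * (\<Sum>q\<le>b. binmass b q
      * of_bool (2 * real p - real a + (2 * real q - real b) < t + 1)))"
    by (simp add: T_def walk_avg_convolution) (simp add: walk_avg_def)
  define hit where "hit p q \<longleftrightarrow> 2 * real p - real a + (2 * real q - real b) \<in> I
      \<and> 2 * real p - real a - (2 * real q - real b) \<in> I" for p q
  have P_sum: "P = (\<Sum>p\<le>a. \<Sum>q\<le>b. binmass a p * binmass b q * of_bool (hit p q))"
    unfolding P_def pair_walk_avg_def walk_avg_def hit_def sum_distrib_left mult.assoc ..
  have "P \<le> 16 / K * T"
  proof (cases "\<exists>p\<le>a. \<exists>q\<le>b. hit p q")
    case False
    then have "P = 0" unfolding P_sum by (intro sum.neutral ballI) auto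
    then show ?thesis using K T0 by simp
  next
    case True
    then obtain p' e where pe: "p' \<le> a" "e \<le> b" "hit p' e" by blast
    \<comment> \<open>The second walk ends at half the difference of two points of \<open>I\<close>,
      which is less than 1 in absolute value; being an integer it is 0. So \<open>b\<close> is even
      and \<open>q\<close> is central.\<close>
    have "real_of_int (2 * int e - int b) = 0"
    proof -
      have "\<bar>2 * real e - real b\<bar> < 1"
        using pe(3) by (auto simp: hit_def I_def)
      then have "\<bar>2 * int e - int b\<bar> < 1" by linarith
      then show ?thesis by simp
    qed
    then have b: "b = 2 * e" by linarith
    \<comment> \<open>Possible endpoints of the first walk are spaced by 2, so only one of them lies
      in \<open>I\<close>.\<close>
    have uniq: "hit p q \<longleftrightarrow> p = p' \<and> q = e" for p q
    proof
      assume h: "hit p q"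
      have "\<bar>2 * real q - real b\<bar> < 1"
        using h by (auto simp: hit_def I_def)
      then have q: "q = e" unfolding b by linarith
      have "\<bar>2 * real p - 2 * real p'\<bar> < 2"
        using h pe(3) by (auto simp: hit_def I_def b q)
      then have "p = p'" by linarith
      with q show "p = p' \<and> q = e" by simp
    qed (use pe in auto)
    have "(\<Sum>q\<le>b. binmass a p * binmass b q * of_bool (hit p q))
        = (if p = p' then binmass a p' * binmass b e else 0)" for p
    proof -
      have "(\<Sum>q\<le>b. binmass a p * binmass b q * of_bool (hit p q))
         = (\<Sum>q\<le>b. if q = e then (if p = p' then binmass a p' * binmass b e else 0) else 0)"
        by (intro sum.cong) (auto simp: uniq)
      then show ?thesis using pe by (simp only: sum.delta finite_atMost) simp
    qed
    then have "P = binmass a p' * binmass b e"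
      unfolding P_sum using pe by simp
    also have "\<dots> \<le> 16 / K * (\<Sum>p\<le>a. binmass a p * (\<Sum>q\<le>2 * e. binmass (2 * e) q * of_bool (p + q \<le> p' + e)))"
      unfolding b by (rule binmass_product_le_tail) (use K pe b in auto)
    also have "\<dots> \<le> 16 / K * T"
      unfolding T_sum b
    proof (intro mult_left_mono sum_mono binmass_nonneg)
      fix p q
      have "2 * real p' - real a < t + 1" using pe(3) by (auto simp: hit_def I_def b)
      moreover have "real p + real q \<le> real p' + real e" if "p + q \<le> p' + e"
        using that by (metis of_nat_add of_nat_le_iff)
      ultimately show "of_bool (p + q \<le> p' + e) \<le>
         (of_bool (2 * real p - real a + (2 * real q - real (2 * e)) < t + 1) :: real)"
        by (auto simp: of_bool_def)
    qed (use K in auto)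
    finally show ?thesis .
  qed
  also have "\<dots> \<le> 16 / K * (2 * walk_avg d (\<lambda>x. of_bool (x < t)))"
    using K T by (intro mult_left_mono) auto
  finally show ?thesis using P0 by (simp add: diff)
qed

lemma pair_walk_avg_both_below_bounds:
  "0 \<le> pair_walk_avg a b (both_below t)"
  "pair_walk_avg a b (both_below t) \<le> pair_walk_avg a b (\<lambda>x _. of_bool (x < t))"
  unfolding pair_walk_avg_def both_below_def
  by (intro walk_avg_nonneg walk_avg_mono; simp)+

lemma pair_walk_avg_fst: "pair_walk_avg a b (\<lambda>x _. \<phi> x) = walk_avg (a + b) \<phi>"
  by (simp add: pair_walk_avg_def walk_avg_convolution)

text \<open>Telescoping of \<open>pair_walk_step\<close>. The \<open>- 1\<close> in the lower bound
  on \<open>b\<close> admits \<open>b = d div 2\<close> also for \<open>d = 1\<close>.\<close>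

lemma pair_walk_decrease:
  fixes t :: real
  assumes "b \<le> b'" "real d / 4 - 1 \<le> real b" "real b' \<le> 3 * real d / 4" "0 < d"
  shows "pair_walk_avg (d - b) b (both_below t) - pair_walk_avg (d - b') b' (both_below t)
    \<in> {0..64 / real d * walk_avg d (\<lambda>x. of_bool (x < t)) * real (b' - b)}"
  using assms(1,3)
proof (induction rule: dec_induct)
  case (step m)
  have m: "Suc m \<le> d" using step.prems \<open>0 < d\<close> by linarith
  \<comment> \<open>With \<open>K = d / 4\<close>: the range of \<open>m\<close> makes both walk
    lengths at least \<open>d / 4 - 1\<close>.\<close>
  have "pair_walk_avg (Suc (d - Suc m)) m (both_below t) - pair_walk_avg (d - Suc m) (Suc m) (both_below t)
    \<in> {0..16 / (real d / 4) * walk_avg d (\<lambda>x. of_bool (x < t))}"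
    by (rule pair_walk_step) (use m step assms in \<open>auto simp: of_nat_diff\<close>)
  moreover have "Suc (d - Suc m) = d - m" using m by simp
  moreover have "real (Suc m - b) = real (m - b) + 1" using step by simp
  moreover have "real m \<le> 3 * real d / 4" using step.prems by simp
  ultimately show ?case using step.IH by (simp add: distrib_left)
qed simp

lemma pair_walk_avg_near_balanced:
  fixes t :: real
  defines "\<delta> \<equiv> \<lambda>d. walk_avg d (\<lambda>x. of_bool (x < t))"
  assumes "0 < d" "b \<le> d"
  shows "\<bar>pair_walk_avg (d - b) b (both_below t)
      - pair_walk_avg (d - d div 2) (d div 2) (both_below t)\<bar>
    \<le> 32 * \<delta> d / real d * (\<bar>2 * real b - real d\<bar> + 1)"
proof -
  define F where "F b = pair_walk_avg (d - b) b (both_below t)" for b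
  have F: "F b \<in> {0..\<delta> d}" if "b \<le> d" for b
    using that pair_walk_avg_both_below_bounds[where a = "d - b" and b = b and t = t]
    by (simp add: F_def \<delta>_def pair_walk_avg_fst)
  have \<delta>0: "0 \<le> \<delta> d" unfolding \<delta>_def by (intro walk_avg_nonneg) auto
  have half: "\<bar>2 * real (d div 2) - real d\<bar> \<le> 1" by (cases "even d") (auto elim!: oddE)
  show ?thesis
  proof (cases "\<bar>2 * real b - real d\<bar> \<le> real d / 2")
    case True
    have d1: "1 \<le> real d" using \<open>0 < d\<close> by simp
    have "\<bar>F b - F (d div 2)\<bar> \<le> 64 / real d * \<delta> d * \<bar>real b - real (d div 2)\<bar>"
    proof (cases "b \<le> d div 2")
      case le: True
      have "F b - F (d div 2) \<in> {0..64 / real d * \<delta> d * real (d div 2 - b)}"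
        unfolding F_def \<delta>_def
        by (rule pair_walk_decrease) (use le True half d1 in \<open>auto simp: abs_le_iff\<close>)
      then show ?thesis using le by (simp add: of_nat_diff)
    next
      case False
      have "F (d div 2) - F b \<in> {0..64 / real d * \<delta> d * real (b - d div 2)}"
        unfolding F_def \<delta>_def
        by (rule pair_walk_decrease) (use False True half d1 in \<open>auto simp: abs_le_iff\<close>)
      then show ?thesis using False by (simp add: of_nat_diff)
    qed
    also have "\<dots> \<le> 64 / real d * \<delta> d * ((\<bar>2 * real b - real d\<bar> + 1) / 2)"
      using \<delta>0 half by (intro mult_left_mono) (simp_all add: abs_if split: if_splits)
    also have "\<dots> = 32 * \<delta> d / real d * (\<bar>2 * real b - real d\<bar> + 1)" by simp
    finally show ?thesis by (simp add: F_def)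
  next
    case False
    \<comment> \<open>Far from balance the claimed bound exceeds \<delta>, so it suffices that both
      values lie between 0 and \<delta>.\<close>
    have "\<bar>F b - F (d div 2)\<bar> \<le> \<delta> d" using F[of b] F[of "d div 2"] \<open>b \<le> d\<close> by auto
    also have "\<dots> \<le> \<delta> d * (32 / real d * (\<bar>2 * real b - real d\<bar> + 1))"
      using False \<open>0 < d\<close> \<delta>0 by (intro mult_right_le_one_le mult_le_cancel_left1[THEN iffD2]) (auto simp: field_simps)
    finally show ?thesis by (simp add: F_def mult_ac)
  qed
qed

lemma cube_avg_mono: "(\<And>x. x \<in> cube d \<Longrightarrow> \<phi> x \<le> \<psi> x) \<Longrightarrow> cube_avg d \<phi> \<le> cube_avg d \<psi>"
  unfolding cube_avg_def by (intro divide_right_mono sum_mono) auto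

lemma cube_avg_const: "cube_avg d (\<lambda>_. c) = c"
  by (simp add: cube_avg_def card_cube)

text \<open>
  The centering term of the covariance is an average over \<open>u\<close> of the joint probability
  for \<open>v\<close> and \<open>u\<close>, so it suffices that the latter depends on \<open>u\<close> in a Lipschitz way.
\<close>

lemma below_covariance_bound:
  fixes t :: real
  defines "\<delta> \<equiv> \<lambda>d. walk_avg d (\<lambda>x. of_bool (x < t))"
  assumes "0 < d" and v: "v \<in> cube d" and u: "u \<in> cube d"
  shows "\<bar>cube_avg d (\<lambda>x. of_bool (dotp d v x < t) * of_bool (dotp d u x < t)) - (\<delta> d)\<^sup>2\<bar>
    \<le> 32 * \<delta> d / real d * (\<bar>dotp d v u\<bar> + sqrt (real d) + 2)"
proof -
  define G where "G u = cube_avg d (\<lambda>x. of_bool (dotp d v x < t) * of_bool (dotp d u x < t))" for u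
  define F where "F = pair_walk_avg (d - d div 2) (d div 2) (both_below t)"
  define M where "M = 32 * \<delta> d / real d"
  have M0: "0 \<le> M"
    unfolding M_def \<delta>_def by (intro divide_nonneg_nonneg mult_nonneg_nonneg walk_avg_nonneg) auto
  have G: "\<bar>G u - F\<bar> \<le> M * (\<bar>dotp d v u\<bar> + 1)" if u: "u \<in> cube d" for u
  proof -
    define b where "b = card {i. i < d \<and> v i \<noteq> u i}"
    have b: "b \<le> d"
      unfolding b_def using card_mono[of "{..<d}" "{i. i < d \<and> v i \<noteq> u i}"] by auto
    have "G u = pair_walk_avg (d - b) b (both_below t)"
      unfolding G_def b_def both_below_def
      by (rule cube_avg_two_dotps[where h = "\<lambda>x y. of_bool (x < t) * of_bool (y < t)"])
         (use v u in \<open>auto simp: cube_def\<close>)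
    moreover have "\<bar>dotp d v u\<bar> = \<bar>2 * real b - real d\<bar>"
      using dotp_eq_disagreements[OF v u] by (simp add: b_def)
    ultimately show ?thesis
      using pair_walk_avg_near_balanced[OF \<open>0 < d\<close> b, of t] by (simp add: M_def F_def \<delta>_def)
  qed
  \<comment> \<open>After exchanging the averages, the inner one runs over \<open>u\<close> for
    fixed \<open>x\<close>. Since \<open>x\<close> is itself a sign vector and \<open>dotp\<close>
    is symmetric, it equals \<delta> for every \<open>x\<close>.\<close>
  have mean: "cube_avg d G = (\<delta> d)\<^sup>2"
  proof -
    have "cube_avg d G = cube_avg d (\<lambda>x. of_bool (dotp d v x < t) * cube_avg d (\<lambda>u. of_bool (dotp d u x < t)))"
      unfolding G_def cube_avg_def sum_divide_distrib sum_distrib_left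
      by (subst sum.swap) simp
    also have "\<dots> = cube_avg d (\<lambda>x. of_bool (dotp d v x < t) * \<delta> d)"
    proof -
      have "cube_avg d (\<lambda>u. of_bool (dotp d u x < t)) = \<delta> d" if "x \<in> cube d" for x
        unfolding \<delta>_def
        by (subst dotp_commute) (rule cube_avg_dotp[OF that, of "\<lambda>x. of_bool (x < t)"])
      then show ?thesis
        unfolding cube_avg_def[of d "\<lambda>x. of_bool (dotp d v x < t) * _ x"]
          cube_avg_def[of d "\<lambda>x. of_bool (dotp d v x < t) * \<delta> d"] by simp
    qed
    also have "\<dots> = cube_avg d (\<lambda>x. of_bool (dotp d v x < t)) * \<delta> d"
      by (simp add: cube_avg_def sum_distrib_right)
    also have "\<dots> = (\<delta> d)\<^sup>2"
      using cube_avg_dotp[OF v, of "\<lambda>x. of_bool (x < t)"] by (simp add: \<delta>_def power2_eq_square)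
    finally show ?thesis .
  qed
  \<comment> \<open>AM-GM at scale \<open>sqrt d\<close>: it trades the first absolute moment of
    \<open>dotp d v u\<close> for the second moment, which is exactly \<open>d\<close>.\<close>
  have abs_le: "\<bar>x\<bar> \<le> (x\<^sup>2 / sqrt (real d) + sqrt (real d)) / 2" for x :: real
  proof -
    have "0 \<le> (\<bar>x\<bar> - sqrt (real d))\<^sup>2" by simp
    then have "2 * \<bar>x\<bar> * sqrt (real d) \<le> x\<^sup>2 + sqrt (real d) * sqrt (real d)"
      unfolding power2_diff by (simp add: power2_eq_square)
    then show ?thesis using \<open>0 < d\<close> by (simp add: field_simps)
  qed
  have "\<bar>(\<delta> d)\<^sup>2 - F\<bar> = \<bar>cube_avg d (\<lambda>u. G u - F)\<bar>"
    using cube_avg_const[of d F] mean by (simp add: cube_avg_def sum_subtractf diff_divide_distrib)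
  also have "\<dots> \<le> cube_avg d (\<lambda>u. \<bar>G u - F\<bar>)"
    unfolding cube_avg_def abs_divide by (auto intro!: divide_right_mono)
  also have "\<dots> \<le> cube_avg d (\<lambda>u. M * ((dotp d v u)\<^sup>2 / sqrt (real d) + sqrt (real d)) / 2 + M)"
  proof (rule cube_avg_mono)
    fix u assume "u \<in> cube d"
    from G[OF this] have "\<bar>G u - F\<bar> \<le> M * (\<bar>dotp d v u\<bar> + 1)" .
    also have "\<dots> \<le> M * (((dotp d v u)\<^sup>2 / sqrt (real d) + sqrt (real d)) / 2 + 1)"
      using abs_le M0 by (intro mult_left_mono add_right_mono) auto
    finally show "\<bar>G u - F\<bar> \<le> M * ((dotp d v u)\<^sup>2 / sqrt (real d) + sqrt (real d)) / 2 + M"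
      by (simp add: distrib_left)
  qed
  also have "\<dots> = walk_avg d (\<lambda>x. M * (x\<^sup>2 / sqrt (real d) + sqrt (real d)) / 2 + M)"
    by (rule cube_avg_dotp[OF v])
  also have "\<dots> = M * (walk_avg d (\<lambda>x. x\<^sup>2) / sqrt (real d) + sqrt (real d)) / 2 + M"
    by (simp only: walk_avg_add walk_avg_divide walk_avg_cmult walk_avg_const)
  also have "\<dots> = M * (sqrt (real d) + 1)"
    using walk_avg_square[of d 0] by (simp add: real_div_sqrt algebra_simps)
  finally have "\<bar>(\<delta> d)\<^sup>2 - F\<bar> \<le> M * (sqrt (real d) + 1)" .
  with G[OF u] have "\<bar>G u - (\<delta> d)\<^sup>2\<bar> \<le> M * (\<bar>dotp d v u\<bar> + sqrt (real d) + 2)"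
    unfolding distrib_left by linarith
  then show ?thesis by (simp add: G_def M_def)
qed

section \<open>Samplewise projection of a product\<close>

lemma set_iid_dist: "set_pmf (iid_dist n P) = {..<n} \<rightarrow>\<^sub>E set_pmf P"
  unfolding iid_dist_def set_Pi_pmf[OF finite_lessThan] PiE_dflt_def by (auto simp: PiE_def extensional_def)

lemma finite_set_iid_dist: "finite (set_pmf P) \<Longrightarrow> finite (set_pmf (iid_dist n P))"
  unfolding set_iid_dist by (intro finite_PiE) auto

lemma expectation_iid_prod:
  fixes f :: "nat \<Rightarrow> 'a \<Rightarrow> real"
  assumes "finite (set_pmf P)"
  shows "measure_pmf.expectation (iid_dist n P) (\<lambda>X. \<Prod>i<n. f i (X i))
    = (\<Prod>i<n. measure_pmf.expectation P (f i))"
proof -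
  have "measure_pmf.expectation (iid_dist n P) (\<lambda>X. \<Prod>i<n. f i (X i))
     = (\<Sum>X\<in>{..<n} \<rightarrow>\<^sub>E set_pmf P. (\<Prod>i<n. f i (X i)) * pmf (iid_dist n P) X)"
    using assms by (intro integral_measure_pmf_real) (auto simp: set_iid_dist intro!: finite_PiE)
  also have "\<dots> = (\<Sum>X\<in>{..<n} \<rightarrow>\<^sub>E set_pmf P. \<Prod>i<n. f i (X i) * pmf P (X i))"
    by (intro sum.cong refl, subst prod.distrib)
       (auto simp: iid_dist_def pmf_Pi PiE_def extensional_def)
  also have "\<dots> = (\<Prod>i<n. \<Sum>z\<in>set_pmf P. f i z * pmf P z)"
    using assms by (subst prod_sum_PiE) auto
  also have "\<dots> = (\<Prod>i<n. measure_pmf.expectation P (f i))"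
    using assms by (intro prod.cong refl integral_measure_pmf_real[symmetric]) auto
  finally show ?thesis .
qed

lemma ip_sum:
  assumes "finite (set_pmf P)" "finite I" "finite J"
  shows "ip P (\<lambda>z. \<Sum>i\<in>I. f i z) (\<lambda>z. \<Sum>j\<in>J. g j z) = (\<Sum>i\<in>I. \<Sum>j\<in>J. ip P (f i) (g j))"
proof -
  have [simp]: "integrable (measure_pmf P) \<phi>" for \<phi> :: "'a \<Rightarrow> real"
    using assms by (intro integrable_measure_pmf_finite)
  show ?thesis by (simp add: ip_def sum_product)
qed

lemma ip_cmult: "ip P (\<lambda>z. c * f z) (\<lambda>z. c' * g z) = c * c' * ip P f g"
  by (simp add: ip_def mult.assoc mult.left_commute[of _ c'])

lemma ip_cong:
  assumes "\<And>z. z \<in> set_pmf P \<Longrightarrow> f z = f' z" "\<And>z. z \<in> set_pmf P \<Longrightarrow> g z = g' z"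
  shows "ip P f g = ip P f' g'"
  unfolding ip_def using assms by (intro integral_cong_AE) (auto simp: AE_measure_pmf_iff)

lemma ip_self_eq_0_iff:
  assumes "finite (set_pmf P)"
  shows "ip P f f = 0 \<longleftrightarrow> (\<forall>z\<in>set_pmf P. f z = 0)"
  unfolding ip_def using assms
  by (subst integral_nonneg_eq_0_iff_AE) (auto simp: AE_measure_pmf_iff intro: integrable_measure_pmf_finite)

text \<open>Padding with factors 1 turns the integrand into a product over all samples. A sample in
  exactly one of \<open>T\<close>, \<open>T'\<close> contributes the mean of \<open>h\<close> or
  \<open>h'\<close>, which is 0.\<close>

lemma ip_iid_subset_prods:
  assumes fin: "finite (set_pmf P)"
    and mean: "measure_pmf.expectation P h = 0" "measure_pmf.expectation P h' = 0"
    and T: "T \<subseteq> {..<n}" "T' \<subseteq> {..<n}"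
  shows "ip (iid_dist n P) (\<lambda>X. \<Prod>i\<in>T. h (X i)) (\<lambda>X. \<Prod>i\<in>T'. h' (X i))
    = (if T = T' then ip P h h' ^ card T else 0)"
proof -
  let ?f = "\<lambda>i z. (if i \<in> T then h z else 1) * (if i \<in> T' then h' z else 1)"
  have "(\<Prod>i\<in>T. h (X i)) * (\<Prod>i\<in>T'. h' (X i)) = (\<Prod>i<n. ?f i (X i))" for X
    using T by (simp add: prod.distrib prod.If_cases Int_absorb1)
  then have "ip (iid_dist n P) (\<lambda>X. \<Prod>i\<in>T. h (X i)) (\<lambda>X. \<Prod>i\<in>T'. h' (X i))
     = (\<Prod>i<n. measure_pmf.expectation P (?f i))"
    unfolding ip_def using expectation_iid_prod[OF fin, of n ?f] by simp
  also have "\<dots> = (if T = T' then ip P h h' ^ card T else 0)"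
  proof (cases "T = T'")
    case True
    have "(\<Prod>i<n. measure_pmf.expectation P (?f i)) = (\<Prod>i<n. if i \<in> T then ip P h h' else 1)"
      using True by (intro prod.cong) (auto simp: ip_def)
    then show ?thesis using True T by (simp add: prod.If_cases Int_absorb1)
  next
    case False
    then obtain i where "i < n" "(i \<in> T) \<noteq> (i \<in> T')" using T by blast
    then have "measure_pmf.expectation P (?f i) = 0" using mean by auto
    then show ?thesis using False \<open>i < n\<close> by (auto intro: prod_zero)
  qed
  finally show ?thesis .
qed

lemma tensor_power_expand:
  "tensor_power n (\<lambda>z. 1 + h z) X = (\<Sum>T\<in>Pow {..<n}. \<Prod>i\<in>T. h (X i))"
  using prod_add[of "{..<n}" "\<lambda>i. h (X i)" "\<lambda>_. 1"] by (simp add: tensor_power_def add.commute)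

text \<open>The terms with at most \<open>k\<close> factors in the expansion of the product of all
  \<open>1 + h (X i)\<close>; this turns out to be the projection.\<close>

definition subset_expansion :: "nat \<Rightarrow> real \<Rightarrow> ('a \<Rightarrow> real) \<Rightarrow> (nat \<Rightarrow> 'a) \<Rightarrow> real" where
  "subset_expansion n k h X = (\<Sum>T | T \<subseteq> {..<n} \<and> real (card T) \<le> k. \<Prod>i\<in>T. h (X i))"

lemma ip_diff_left:
  assumes "finite (set_pmf P)"
  shows "ip P (\<lambda>z. f z - g z) q = ip P f q - ip P g q"
proof -
  have [simp]: "integrable (measure_pmf P) \<phi>" for \<phi> :: "'a \<Rightarrow> real"
    using assms by (intro integrable_measure_pmf_finite)
  show ?thesis by (simp add: ip_def left_diff_distrib)
qed

text \<open>Two candidates differ by an element of \<open>V\<close> orthogonal to itself, so they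
  agree on the support; the choice operator leaves the values elsewhere undetermined.\<close>

lemma orth_proj_eqI:
  assumes fin: "finite (set_pmf P)"
    and V: "\<And>p q. p \<in> V \<Longrightarrow> q \<in> V \<Longrightarrow> (\<lambda>z. p z - q z) \<in> V"
    and p: "p \<in> V" "\<And>q. q \<in> V \<Longrightarrow> ip P (\<lambda>z. f z - p z) q = 0"
    and z: "z \<in> set_pmf P"
  shows "orth_proj P V f z = p z"
proof -
  define p' where "p' = orth_proj P V f"
  have "p' \<in> V \<and> (\<forall>q\<in>V. ip P (\<lambda>z. f z - p' z) q = 0)"
    unfolding p'_def orth_proj_def by (rule someI[of _ p]) (use p in blast)
  moreover from this have "(\<lambda>z. p' z - p z) \<in> V" using V p by blast
  ultimately have "ip P (\<lambda>z. f z - p z) (\<lambda>z. p' z - p z) - ip P (\<lambda>z. f z - p' z) (\<lambda>z. p' z - p z) = 0"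
    using p by simp
  then have "ip P (\<lambda>z. p' z - p z) (\<lambda>z. p' z - p z) = 0"
    by (simp flip: ip_diff_left[OF fin])
  then show ?thesis using z by (simp add: ip_self_eq_0_iff[OF fin] p'_def)
qed

section \<open>Samplewise polynomials and the projection of a tensor power\<close>

lemma samplewise_polys_linear_combination:
  assumes "finite I" "\<And>i. i \<in> I \<Longrightarrow> f i \<in> samplewise_polys d n r k"
  shows "(\<lambda>X. \<Sum>i\<in>I. c i * f i X) \<in> samplewise_polys d n r k"
  using assms
proof (induction I rule: finite_induct)
  case empty
  show ?case unfolding samplewise_polys_def
    by (intro CollectI exI[of _ "{}"] exI[of _ "\<lambda>_. 0"]) auto
next
  case (insert i I)
  obtain F a where F: "finite F" "F \<subseteq> samplewise_exponents d n r k"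
    "f i = (\<lambda>X. \<Sum>e\<in>F. a e * samples_monomial d n e X)"
    using insert.prems[of i] unfolding samplewise_polys_def by blast
  obtain G b where G: "finite G" "G \<subseteq> samplewise_exponents d n r k"
    "(\<lambda>X. \<Sum>i\<in>I. c i * f i X) = (\<lambda>X. \<Sum>e\<in>G. b e * samples_monomial d n e X)"
    using insert.IH insert.prems unfolding samplewise_polys_def by blast
  let ?c = "\<lambda>e. (if e \<in> F then c i * a e else 0) + (if e \<in> G then b e else 0)"
  have "(\<Sum>j\<in>insert i I. c j * f j X) = (\<Sum>e\<in>F \<union> G. ?c e * samples_monomial d n e X)" for X
  proof -
    have "(\<Sum>e\<in>F \<union> G. ?c e * samples_monomial d n e X)
       = (\<Sum>e\<in>F \<union> G. if e \<in> F then c i * (a e * samples_monomial d n e X) else 0)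
         + (\<Sum>e\<in>F \<union> G. if e \<in> G then b e * samples_monomial d n e X else 0)"
      unfolding sum.distrib[symmetric] by (intro sum.cong) (auto simp: distrib_right)
    also have "\<dots> = (\<Sum>e\<in>F. c i * (a e * samples_monomial d n e X)) + (\<Sum>e\<in>G. b e * samples_monomial d n e X)"
      using F(1) G(1) by (simp add: sum.If_cases Int_absorb1 Int_commute)
    also have "\<dots> = c i * f i X + (\<Sum>i\<in>I. c i * f i X)"
      using F(3) fun_cong[OF G(3), of X] by (simp add: sum_distrib_left)
    finally show ?thesis using insert.hyps by simp
  qed
  then show ?case unfolding samplewise_polys_def using F G
    by (intro CollectI exI[of _ "F \<union> G"] exI[of _ ?c]) auto
qed

lemma samplewise_polys_diff:
  assumes "p \<in> samplewise_polys d n r k" "q \<in> samplewise_polys d n r k"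
  shows "(\<lambda>X. p X - q X) \<in> samplewise_polys d n r k"
  using samplewise_polys_linear_combination[of "{True, False}" "\<lambda>b. if b then p else q" d n r k
      "\<lambda>b. if b then 1 else -1"] assms by simp

lemma monomial_in_samplewise_polys:
  "e \<in> samplewise_exponents d n r k \<Longrightarrow> samples_monomial d n e \<in> samplewise_polys d n r k"
  unfolding samplewise_polys_def
  by (intro CollectI exI[of _ "{e}"] exI[of _ "\<lambda>_. 1"]) auto

abbreviation sample_space :: "nat \<Rightarrow> ((nat \<Rightarrow> real) \<times> real) set" where
  "sample_space d \<equiv> cube d \<times> {0, 1}"

text \<open>Exponents 0 and 1 are enough on the sample space, where \<open>x\<^sub>j^2 = 1\<close>
  and \<open>y^2 = y\<close>; extensionality makes the set finite.\<close>

definition multilinear_exponents :: "nat \<Rightarrow> sample_exponent set" where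
  "multilinear_exponents d = ({..<d} \<rightarrow>\<^sub>E {0, 1}) \<times> {0, 1}"

lemma finite_multilinear_exponents: "finite (multilinear_exponents d)"
  unfolding multilinear_exponents_def by (intro finite_cartesian_product finite_PiE) auto

text \<open>The indicator of \<open>w = (x', y')\<close> is the product of the factors
  \<open>(1 + x' j * x j) / 2\<close> and of \<open>(1 - y') + (2 * y' - 1) * y\<close>; multiplying
  out gives the coefficients.\<close>

lemma point_indicator_multilinear:
  assumes "w \<in> sample_space d"
  shows "\<exists>a. \<forall>z\<in>sample_space d.
    of_bool (z = w) = (\<Sum>e\<in>multilinear_exponents d. a e * sample_monomial d e z)"
proof -
  define \<alpha> where "\<alpha> j m = (if m = 0 then 1 / 2 else fst w j / 2)" for j and m :: nat
  define \<beta> where "\<beta> m = (if m = 0 then 1 - snd w else 2 * snd w - 1)" for m :: nat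
  show ?thesis
  proof (intro exI ballI)
    fix z assume "z \<in> sample_space d"
    then obtain x y where z: "z = (x, y)" "x \<in> cube d" "y = 0 \<or> y = 1" by (cases z) auto
    obtain x' y' where w: "w = (x', y')" "x' \<in> cube d" "y' = 0 \<or> y' = 1" using assms by (cases w) auto
    have cube: "x j = -1 \<or> x j = 1" "x' j = -1 \<or> x' j = 1" if "j < d" for j
      using z w that by (auto simp: cube_def)
    have "(of_bool (x = x') :: real) = (\<Prod>j<d. 1 / 2 + x' j / 2 * x j)"
    proof (cases "x = x'")
      case True
      then have "1 / 2 + x' j / 2 * x j = 1" if "j < d" for j using cube[OF that] by auto
      then show ?thesis using True by simp
    next
      case False
      then obtain j where "j < d" "x j \<noteq> x' j"
        using z w unfolding cube_def by (metis PiE_ext lessThan_iff)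
      then have "1 / 2 + x' j / 2 * x j = 0" using cube[of j] by auto
      then show ?thesis using False \<open>j < d\<close> by (auto intro: prod_zero)
    qed
    also have "\<dots> = (\<Prod>j<d. \<Sum>m\<in>{0, 1}. \<alpha> j m * x j ^ m)"
      by (simp add: \<alpha>_def w)
    also have "\<dots> = (\<Sum>g\<in>{..<d} \<rightarrow>\<^sub>E {0, 1}. \<Prod>j<d. \<alpha> j (g j) * x j ^ g j)"
      by (rule prod_sum_PiE) auto
    finally have x: "(of_bool (x = x') :: real) = (\<Sum>g\<in>{..<d} \<rightarrow>\<^sub>E {0, 1}. \<Prod>j<d. \<alpha> j (g j) * x j ^ g j)" .
    have y: "(of_bool (y = y') :: real) = (\<Sum>m\<in>{0, 1}. \<beta> m * y ^ m)"
      using z w by (auto simp: \<beta>_def)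
    have "(of_bool (z = w) :: real) = of_bool (x = x') * of_bool (y = y')"
      by (simp add: z w)
    also have "\<dots> = (\<Sum>e\<in>multilinear_exponents d.
        (\<Prod>j<d. \<alpha> j (fst e j) * x j ^ fst e j) * (\<beta> (snd e) * y ^ snd e))"
      unfolding x y sum_product multilinear_exponents_def
      by (simp only: sum.cartesian_product case_prod_unfold)
    also have "\<dots> = (\<Sum>e\<in>multilinear_exponents d.
        ((\<Prod>j<d. \<alpha> j (fst e j)) * \<beta> (snd e)) * sample_monomial d e z)"
      by (simp add: sample_monomial_def z prod.distrib mult_ac)
    finally show "of_bool (z = w) = (\<Sum>e\<in>multilinear_exponents d.
        ((\<Prod>j<d. \<alpha> j (fst e j)) * \<beta> (snd e)) * sample_monomial d e z)" .
  qed
qed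

lemma function_multilinear:
  "\<exists>a. \<forall>z\<in>sample_space d. h z = (\<Sum>e\<in>multilinear_exponents d. a e * sample_monomial d e z)"
proof -
  have "\<forall>w\<in>sample_space d. \<exists>a. \<forall>z\<in>sample_space d.
      of_bool (z = w) = (\<Sum>e\<in>multilinear_exponents d. a e * sample_monomial d e z)"
    using point_indicator_multilinear by (rule ballI)
  from bchoice[OF this] obtain A where A: "\<forall>w\<in>sample_space d. \<forall>z\<in>sample_space d.
      of_bool (z = w) = (\<Sum>e\<in>multilinear_exponents d. A w e * sample_monomial d e z)" ..
  have fin: "finite (sample_space d)" by (simp add: finite_cube)
  have "h z = (\<Sum>e\<in>multilinear_exponents d. (\<Sum>w\<in>sample_space d. h w * A w e) * sample_monomial d e z)"
    if z: "z \<in> sample_space d" for z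
  proof -
    have "h z = (\<Sum>w\<in>sample_space d. if w = z then h w else 0)"
      using z fin by (simp only: sum.delta if_True)
    also have "\<dots> = (\<Sum>w\<in>sample_space d. h w * of_bool (z = w))"
      by (intro sum.cong refl) (simp add: of_bool_def)
    also have "\<dots> = (\<Sum>w\<in>sample_space d. h w * (\<Sum>e\<in>multilinear_exponents d. A w e * sample_monomial d e z))"
      using A z by (intro sum.cong refl arg_cong2[where f = "(*)"]) blast
    also have "\<dots> = (\<Sum>e\<in>multilinear_exponents d. (\<Sum>w\<in>sample_space d. h w * A w e) * sample_monomial d e z)"
      unfolding sum_distrib_left sum_distrib_right by (subst sum.swap) (simp add: mult.assoc)
    finally show ?thesis .
  qed
  then show ?thesis by (intro exI ballI)
qed

lemma subset_prod_poly:
  assumes "T \<subseteq> {..<n}" "real (card T) \<le> k"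
  shows "\<exists>p\<in>samplewise_polys d n \<infinity> k. \<forall>X\<in>{..<n} \<rightarrow>\<^sub>E sample_space d. p X = (\<Prod>i\<in>T. h (X i))"
proof -
  obtain a where a: "\<forall>z\<in>sample_space d.
      h z = (\<Sum>e\<in>multilinear_exponents d. a e * sample_monomial d e z)"
    using function_multilinear[of d h] by (elim exE)
  \<comment> \<open>Samples outside \<open>T\<close> get exponent zero, so each monomial uses at
    most \<open>card T\<close> samples.\<close>
  define ex :: "(nat \<Rightarrow> sample_exponent) \<Rightarrow> nat \<Rightarrow> sample_exponent" where
    "ex \<phi> i = (if i \<in> T then \<phi> i else (\<lambda>_. 0, 0))" for \<phi> i
  define p where "p = (\<lambda>X. \<Sum>\<phi>\<in>T \<rightarrow>\<^sub>E multilinear_exponents d.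
      (\<Prod>i\<in>T. a (\<phi> i)) * samples_monomial d n (ex \<phi>) X)"
  have T: "finite T" using assms finite_subset by blast
  have "p \<in> samplewise_polys d n \<infinity> k"
    unfolding p_def
  proof (intro samplewise_polys_linear_combination monomial_in_samplewise_polys finite_PiE T
      finite_multilinear_exponents)
    fix \<phi>
    have "{i \<in> {..<n}. sample_degree d (ex \<phi> i) \<noteq> 0} \<subseteq> T"
      by (auto simp: ex_def sample_degree_def split: if_splits)
    then have "card {i \<in> {..<n}. sample_degree d (ex \<phi> i) \<noteq> 0} \<le> card T"
      using T card_mono by blast
    then show "ex \<phi> \<in> samplewise_exponents d n \<infinity> k"
      using assms(2) by (simp add: samplewise_exponents_def)
  qed
  moreover have "p X = (\<Prod>i\<in>T. h (X i))" if X: "X \<in> {..<n} \<rightarrow>\<^sub>E sample_space d" for X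
  proof -
    have "X i \<in> sample_space d" if "i \<in> T" for i using X that assms(1) by (auto simp: PiE_iff)
    then have "(\<Prod>i\<in>T. h (X i)) = (\<Prod>i\<in>T. \<Sum>e\<in>multilinear_exponents d. a e * sample_monomial d e (X i))"
      using a by (intro prod.cong refl) blast
    also have "\<dots> = (\<Sum>\<phi>\<in>T \<rightarrow>\<^sub>E multilinear_exponents d. \<Prod>i\<in>T. a (\<phi> i) * sample_monomial d (\<phi> i) (X i))"
      by (rule prod_sum_PiE[OF T finite_multilinear_exponents])
    also have "\<dots> = p X"
      unfolding p_def
    proof (intro sum.cong refl)
      fix \<phi>
      have "samples_monomial d n (ex \<phi>) X
          = (\<Prod>i<n. if i \<in> T then sample_monomial d (\<phi> i) (X i) else 1)"
        unfolding samples_monomial_def ex_def by (intro prod.cong) (auto simp: sample_monomial_def)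
      also have "\<dots> = (\<Prod>i\<in>T. sample_monomial d (\<phi> i) (X i))"
        using assms(1) by (simp add: prod.If_cases Int_absorb1)
      finally show "(\<Prod>i\<in>T. a (\<phi> i) * sample_monomial d (\<phi> i) (X i))
          = (\<Prod>i\<in>T. a (\<phi> i)) * samples_monomial d n (ex \<phi>) X"
        by (simp add: prod.distrib)
    qed
    finally show ?thesis by simp
  qed
  ultimately show ?thesis by blast
qed

text \<open>A monomial using at most \<open>k\<close> samples misses some sample of the larger set
  \<open>T\<close>; that sample enters only through \<open>h\<close>, which has mean zero.\<close>

lemma ip_subset_prod_monomial:
  assumes fin: "finite (set_pmf P)" and mean: "measure_pmf.expectation P h = 0"
    and T: "T \<subseteq> {..<n}" "\<not> real (card T) \<le> k" and e: "e \<in> samplewise_exponents d n r k"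
  shows "ip (iid_dist n P) (\<lambda>X. \<Prod>i\<in>T. h (X i)) (samples_monomial d n e) = 0"
proof -
  let ?f = "\<lambda>i z. (if i \<in> T then h z else 1) * sample_monomial d (e i) z"
  have "(\<Prod>i\<in>T. h (X i)) * samples_monomial d n e X = (\<Prod>i<n. ?f i (X i))" for X
    using T by (simp add: prod.distrib prod.If_cases Int_absorb1 samples_monomial_def)
  then have *: "ip (iid_dist n P) (\<lambda>X. \<Prod>i\<in>T. h (X i)) (samples_monomial d n e)
     = (\<Prod>i<n. measure_pmf.expectation P (?f i))"
    unfolding ip_def using expectation_iid_prod[OF fin, of n ?f] by simp
  have "\<not> T \<subseteq> {i \<in> {..<n}. sample_degree d (e i) \<noteq> 0}"
  proof
    assume "T \<subseteq> {i \<in> {..<n}. sample_degree d (e i) \<noteq> 0}"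
    then have "card T \<le> card {i \<in> {..<n}. sample_degree d (e i) \<noteq> 0}" by (intro card_mono) auto
    then show False using T e by (simp add: samplewise_exponents_def)
  qed
  then obtain i where i: "i \<in> T" "i < n" "sample_degree d (e i) = 0" using T by auto
  then have "sample_monomial d (e i) z = 1" for z
    by (auto simp: sample_degree_def sample_monomial_def)
  then have "measure_pmf.expectation P (?f i) = 0" using i mean by simp
  then show ?thesis unfolding * using \<open>i < n\<close> by (auto intro: prod_zero)
qed

text \<open>In the expansion over subsets, the small sets give polynomials of the right samplewise
  degree and the large ones are orthogonal to all such polynomials.\<close>

lemma samplewise_proj_tensor_power:
  assumes supp: "set_pmf P \<subseteq> sample_space d"
    and L: "\<And>z. z \<in> set_pmf P \<Longrightarrow> L z = 1 + h z"
    and mean: "measure_pmf.expectation P h = 0"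
    and X: "X \<in> set_pmf (iid_dist n P)"
  shows "samplewise_proj d n P \<infinity> k (tensor_power n L) X = subset_expansion n k h X"
proof -
  have fin: "finite (set_pmf P)"
    using supp finite_cube[of d] by (auto intro: finite_subset)
  note fin' = finite_set_iid_dist[OF fin, of n]
  define \<T> where "\<T> = {T. T \<subseteq> {..<n} \<and> real (card T) \<le> k}"
  define \<U> where "\<U> = {T. T \<subseteq> {..<n} \<and> \<not> real (card T) \<le> k}"
  have finT: "finite \<T>" "finite \<U>" unfolding \<T>_def \<U>_def by auto
  have sub: "Y \<in> {..<n} \<rightarrow>\<^sub>E sample_space d" if "Y \<in> set_pmf (iid_dist n P)" for Y
    using that supp unfolding set_iid_dist by (auto simp: PiE_iff)
  have "\<forall>T\<in>\<T>. \<exists>p. p \<in> samplewise_polys d n \<infinity> k \<and>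
      (\<forall>Y\<in>{..<n} \<rightarrow>\<^sub>E sample_space d. p Y = (\<Prod>i\<in>T. h (Y i)))"
    using subset_prod_poly[of _ n k d h] unfolding \<T>_def by blast
  from bchoice[OF this] obtain p where p: "\<And>T. T \<in> \<T> \<Longrightarrow> p T \<in> samplewise_polys d n \<infinity> k"
    "\<And>T Y. T \<in> \<T> \<Longrightarrow> Y \<in> {..<n} \<rightarrow>\<^sub>E sample_space d \<Longrightarrow> p T Y = (\<Prod>i\<in>T. h (Y i))"
    by blast
  \<comment> \<open>The candidate has to be a polynomial as a function, not only on the support,
    hence the representatives \<open>p T\<close> of the subset products.\<close>
  define q where "q = (\<lambda>Y. \<Sum>T\<in>\<T>. 1 * p T Y)"
  have q: "q Y = subset_expansion n k h Y" if "Y \<in> set_pmf (iid_dist n P)" for Y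
    unfolding q_def subset_expansion_def \<T>_def[symmetric] using p sub[OF that] by simp
  have diff: "tensor_power n L Y - q Y = (\<Sum>T\<in>\<U>. \<Prod>i\<in>T. h (Y i))"
    if Y: "Y \<in> set_pmf (iid_dist n P)" for Y
  proof -
    have "tensor_power n L Y = tensor_power n (\<lambda>z. 1 + h z) Y"
      unfolding tensor_power_def using Y L by (intro prod.cong) (auto simp: set_iid_dist PiE_iff)
    also have "\<dots> = (\<Sum>T\<in>\<T> \<union> \<U>. \<Prod>i\<in>T. h (Y i))"
      unfolding tensor_power_expand by (intro sum.cong) (auto simp: \<T>_def \<U>_def)
    also have "\<dots> = (\<Sum>T\<in>\<T>. \<Prod>i\<in>T. h (Y i)) + (\<Sum>T\<in>\<U>. \<Prod>i\<in>T. h (Y i))"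
      using finT by (intro sum.union_disjoint) (auto simp: \<T>_def \<U>_def)
    finally show ?thesis using q[OF Y] by (simp add: subset_expansion_def \<T>_def)
  qed
  have "samplewise_proj d n P \<infinity> k (tensor_power n L) X = q X"
    unfolding samplewise_proj_def
  proof (rule orth_proj_eqI[OF fin' samplewise_polys_diff _ _ X])
    show "q \<in> samplewise_polys d n \<infinity> k"
      unfolding q_def by (intro samplewise_polys_linear_combination finT p)
    fix r assume "r \<in> samplewise_polys d n \<infinity> k"
    then obtain F a where r: "finite F" "F \<subseteq> samplewise_exponents d n \<infinity> k"
      "r = (\<lambda>X. \<Sum>e\<in>F. a e * samples_monomial d n e X)"
      unfolding samplewise_polys_def by blast
    have "ip (iid_dist n P) (\<lambda>Y. tensor_power n L Y - q Y) r
       = ip (iid_dist n P) (\<lambda>Y. \<Sum>T\<in>\<U>. 1 * (\<Prod>i\<in>T. h (Y i))) r"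
      using diff by (intro ip_cong) auto
    also have "\<dots> = (\<Sum>T\<in>\<U>. \<Sum>e\<in>F. 1 * a e * ip (iid_dist n P) (\<lambda>Y. \<Prod>i\<in>T. h (Y i)) (samples_monomial d n e))"
      unfolding r(3) by (subst ip_sum[OF fin' finT(2) r(1)]) (simp only: ip_cmult)
    also have "\<dots> = 0"
    proof (intro sum.neutral ballI)
      fix T e assume "T \<in> \<U>" "e \<in> F"
      then have "ip (iid_dist n P) (\<lambda>Y. \<Prod>i\<in>T. h (Y i)) (samples_monomial d n e) = 0"
        using r(2) by (intro ip_subset_prod_monomial[OF fin mean, where k = k and r = \<infinity>]) (auto simp: \<U>_def)
      then show "1 * a e * ip (iid_dist n P) (\<lambda>Y. \<Prod>i\<in>T. h (Y i)) (samples_monomial d n e) = 0" by simp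
    qed
    finally show "ip (iid_dist n P) (\<lambda>Y. tensor_power n L Y - q Y) r = 0" .
  qed auto
  with q[OF X] show ?thesis by simp
qed

section \<open>The squared norm as a sum over pairs of directions\<close>

text \<open>Since \<open>0 \<le> k\<close>, the truncation contains the empty set, whose term 1
  cancels the subtracted constant. By orthogonality of the remaining subset products only
  \<open>T = T'\<close> survives.\<close>

lemma L2norm_averaged_projection:
  fixes h :: "'v \<Rightarrow> (nat \<Rightarrow> real) \<times> real \<Rightarrow> real"
  assumes supp: "set_pmf P \<subseteq> sample_space d" and S: "finite S" "S \<noteq> {}" and k: "0 \<le> k"
    and L: "\<And>v z. v \<in> S \<Longrightarrow> z \<in> set_pmf P \<Longrightarrow> L v z = 1 + h v z"
    and mean: "\<And>v. v \<in> S \<Longrightarrow> measure_pmf.expectation P (h v) = 0"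
  shows "(L2norm (iid_dist n P)
      (\<lambda>X. measure_pmf.expectation (pmf_of_set S)
        (\<lambda>v. samplewise_proj d n P \<infinity> k (tensor_power n (L v)) X) - 1))\<^sup>2
    = (\<Sum>v\<in>S. \<Sum>u\<in>S. \<Sum>T | T \<subseteq> {..<n} \<and> T \<noteq> {} \<and> real (card T) \<le> k.
        ip P (h v) (h u) ^ card T) / (real (card S))\<^sup>2"
proof -
  have fin: "finite (set_pmf P)"
    using supp finite_cube[of d] by (auto intro: finite_subset)
  note fin' = finite_set_iid_dist[OF fin, of n]
  define \<T> where "\<T> = {T. T \<subseteq> {..<n} \<and> T \<noteq> {} \<and> real (card T) \<le> k}"
  have finT: "finite \<T>" unfolding \<T>_def by auto
  define c where "c = 1 / real (card S)"
  have c: "c * real (card S) = 1" using S by (simp add: c_def)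
  define G where "G = (\<lambda>X. c * (\<Sum>v\<in>S. \<Sum>T\<in>\<T>. \<Prod>i\<in>T. h v (X i)))"
  have G: "measure_pmf.expectation (pmf_of_set S)
        (\<lambda>v. samplewise_proj d n P \<infinity> k (tensor_power n (L v)) X) - 1 = G X"
    if X: "X \<in> set_pmf (iid_dist n P)" for X
  proof -
    have e: "subset_expansion n k f X = 1 + (\<Sum>T\<in>\<T>. \<Prod>i\<in>T. f (X i))" for f
    proof -
      have "{T. T \<subseteq> {..<n} \<and> real (card T) \<le> k} = insert {} \<T>" "{} \<notin> \<T>"
        using k by (auto simp: \<T>_def)
      then show ?thesis using finT by (simp add: subset_expansion_def)
    qed
    have "measure_pmf.expectation (pmf_of_set S)
        (\<lambda>v. samplewise_proj d n P \<infinity> k (tensor_power n (L v)) X)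
      = c * (\<Sum>v\<in>S. samplewise_proj d n P \<infinity> k (tensor_power n (L v)) X)"
      using S by (simp add: integral_pmf_of_set c_def)
    also have "(\<Sum>v\<in>S. samplewise_proj d n P \<infinity> k (tensor_power n (L v)) X)
      = (\<Sum>v\<in>S. 1 + (\<Sum>T\<in>\<T>. \<Prod>i\<in>T. h v (X i)))"
      unfolding e[symmetric] using L mean
      by (intro sum.cong refl samplewise_proj_tensor_power[OF supp _ _ X]) auto
    finally show ?thesis using c by (simp add: G_def sum.distrib distrib_left)
  qed
  have "(L2norm (iid_dist n P)
      (\<lambda>X. measure_pmf.expectation (pmf_of_set S)
        (\<lambda>v. samplewise_proj d n P \<infinity> k (tensor_power n (L v)) X) - 1))\<^sup>2
     = ip (iid_dist n P) G G"
  proof -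
    have "0 \<le> ip (iid_dist n P) G G" unfolding ip_def by (rule integral_nonneg_AE) auto
    moreover have "L2norm (iid_dist n P) (\<lambda>X. measure_pmf.expectation (pmf_of_set S)
        (\<lambda>v. samplewise_proj d n P \<infinity> k (tensor_power n (L v)) X) - 1)
      = sqrt (ip (iid_dist n P) G G)"
      unfolding L2norm_def by (intro arg_cong[where f = sqrt] ip_cong G) auto
    ultimately show ?thesis by simp
  qed
  also have "\<dots> = c\<^sup>2 * (\<Sum>v\<in>S. \<Sum>u\<in>S. \<Sum>T\<in>\<T>. \<Sum>T'\<in>\<T>.
      ip (iid_dist n P) (\<lambda>X. \<Prod>i\<in>T. h v (X i)) (\<lambda>X. \<Prod>i\<in>T'. h u (X i)))"
    unfolding G_def ip_cmult ip_sum[OF fin' S(1) S(1)] ip_sum[OF fin' finT finT]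
    by (simp add: power2_eq_square)
  also have "\<dots> = c\<^sup>2 * (\<Sum>v\<in>S. \<Sum>u\<in>S. \<Sum>T\<in>\<T>. ip P (h v) (h u) ^ card T)"
  proof -
    have "(\<Sum>T'\<in>\<T>. ip (iid_dist n P) (\<lambda>X. \<Prod>i\<in>T. h v (X i)) (\<lambda>X. \<Prod>i\<in>T'. h u (X i)))
       = ip P (h v) (h u) ^ card T" if "v \<in> S" "u \<in> S" "T \<in> \<T>" for v u T
    proof -
      have "(\<Sum>T'\<in>\<T>. ip (iid_dist n P) (\<lambda>X. \<Prod>i\<in>T. h v (X i)) (\<lambda>X. \<Prod>i\<in>T'. h u (X i)))
         = (\<Sum>T'\<in>\<T>. if T = T' then ip P (h v) (h u) ^ card T else 0)"
        using that by (intro sum.cong refl ip_iid_subset_prods[OF fin mean mean]) (auto simp: \<T>_def)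
      then show ?thesis using finT that by simp
    qed
    then show ?thesis by simp
  qed
  finally show ?thesis by (simp add: \<T>_def c_def power_divide)
qed

text \<open>Sets are grouped by their size \<open>j \<ge> 1\<close>; there are at most
  \<open>n ^ j\<close> of each size.\<close>

lemma sum_subsets_power_le:
  assumes k: "0 \<le> k" and q: "\<bar>q\<bar> * real n \<le> N"
  shows "(\<Sum>T | T \<subseteq> {..<n} \<and> T \<noteq> {} \<and> real (card T) \<le> k. q ^ card T) \<le> (\<Sum>j=1..nat \<lfloor>k\<rfloor>. N ^ j)"
proof -
  define \<T> where "\<T> = {T. T \<subseteq> {..<n} \<and> T \<noteq> {} \<and> real (card T) \<le> k}"
  have N: "0 \<le> \<bar>q\<bar> * real n" by simp
  have card: "card T \<in> {1..nat \<lfloor>k\<rfloor>}" if "T \<in> \<T>" for T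
  proof -
    have "finite T" using that finite_subset[of T "{..<n}"] by (auto simp: \<T>_def)
    then have "card T \<noteq> 0" using that by (auto simp: \<T>_def)
    moreover have "card T \<le> nat \<lfloor>k\<rfloor>" using that by (auto simp: \<T>_def le_nat_floor)
    ultimately show ?thesis by auto
  qed
  have "(\<Sum>T\<in>\<T>. q ^ card T) = (\<Sum>j\<in>{1..nat \<lfloor>k\<rfloor>}. \<Sum>T | T \<in> \<T> \<and> card T = j. q ^ card T)"
    by (rule sum.group[symmetric]) (use card in \<open>auto simp: \<T>_def simp del: atLeastAtMost_iff\<close>)
  also have "\<dots> \<le> (\<Sum>j=1..nat \<lfloor>k\<rfloor>. N ^ j)"
  proof (intro sum_mono)
    fix j
    have "(\<Sum>T | T \<in> \<T> \<and> card T = j. q ^ card T) \<le> (\<Sum>T | T \<in> \<T> \<and> card T = j. \<bar>q\<bar> ^ j)"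
      by (intro sum_mono) (auto simp: power_abs[symmetric])
    also have "\<dots> \<le> (\<Sum>T | T \<subseteq> {..<n} \<and> card T = j. \<bar>q\<bar> ^ j)"
      by (intro sum_mono2) (auto simp: \<T>_def)
    also have "\<dots> = real (n choose j) * \<bar>q\<bar> ^ j"
      using n_subsets[of "{..<n}" j] by simp
    also have "\<dots> \<le> real n ^ j * \<bar>q\<bar> ^ j"
    proof (intro mult_right_mono)
      show "real (n choose j) \<le> real n ^ j"
        using binomial_le_pow[of j n] by (cases "j \<le> n") (auto simp flip: of_nat_power simp: binomial_eq_0)
    qed simp
    also have "\<dots> = (\<bar>q\<bar> * real n) ^ j" by (simp add: power_mult_distrib)
    also have "\<dots> \<le> N ^ j" using q N by (intro power_mono)
    finally show "(\<Sum>T | T \<in> \<T> \<and> card T = j. q ^ card T) \<le> N ^ j" .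
  qed
  finally show ?thesis by (simp add: \<T>_def)
qed

section \<open>Likelihood ratios of noisy halfspaces\<close>

definition label_prob :: "real \<Rightarrow> real \<Rightarrow> real" where
  "label_prob \<epsilon> \<eta> = \<eta> + 2 * (1 - 2 * \<eta>) * \<epsilon>"

text \<open>The likelihood ratio minus one, in closed form for a halfspace of mean
  \<open>2 * \<epsilon>\<close>; this is the \<open>h\<^sub>v\<close> of the expansion.\<close>

definition centered_ratio ::
  "nat \<Rightarrow> real \<Rightarrow> real \<Rightarrow> real \<Rightarrow> (nat \<Rightarrow> real) \<Rightarrow> (nat \<Rightarrow> real) \<times> real \<Rightarrow> real" where
  "centered_ratio d \<epsilon> \<eta> t v z = (1 - 2 * \<eta>) * (halfspace d t v (fst z) - 2 * \<epsilon>)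
     * (if snd z = 1 then 1 / label_prob \<epsilon> \<eta> else - 1 / (1 - label_prob \<epsilon> \<eta>))"

text \<open>Each quantity is its bound plus visibly nonnegative products. The factor
  \<open>1 - 2 * \<epsilon>\<close> in the second bound later cancels the \<delta> of the covariance
  estimate.\<close>

lemma label_prob_bounds:
  assumes "0 < \<epsilon>" "\<epsilon> < 1 / 2" "0 < \<eta>" "\<eta> < 1 / 2"
  shows "\<epsilon> \<le> label_prob \<epsilon> \<eta>" "(1 - 2 * \<epsilon>) / 2 \<le> 1 - label_prob \<epsilon> \<eta>"
    "0 < label_prob \<epsilon> \<eta>" "label_prob \<epsilon> \<eta> < 1"
proof -
  have "label_prob \<epsilon> \<eta> = \<epsilon> + (\<eta> * (1 - 2 * \<epsilon>) + \<epsilon> * (1 - 2 * \<eta>))"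
    by (simp add: label_prob_def algebra_simps)
  moreover have "0 \<le> \<eta> * (1 - 2 * \<epsilon>)" "0 \<le> \<epsilon> * (1 - 2 * \<eta>)" using assms by auto
  ultimately show 1: "\<epsilon> \<le> label_prob \<epsilon> \<eta>" by linarith
  have "1 - label_prob \<epsilon> \<eta> = (1 - 2 * \<epsilon>) / 2 + ((1 - 2 * \<epsilon>) * (1 / 2 - \<eta>) + 2 * \<epsilon> * \<eta>)"
    by (simp add: label_prob_def field_simps)
  moreover have "0 \<le> (1 - 2 * \<epsilon>) * (1 / 2 - \<eta>)" "0 \<le> 2 * \<epsilon> * \<eta>" using assms by auto
  ultimately show 2: "(1 - 2 * \<epsilon>) / 2 \<le> 1 - label_prob \<epsilon> \<eta>" by linarith
  show "0 < label_prob \<epsilon> \<eta>" using 1 assms by linarith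
  have "0 < (1 - 2 * \<epsilon>) / 2" using assms by simp
  with 2 show "label_prob \<epsilon> \<eta> < 1" by linarith
qed

lemma pmf_label_dist:
  assumes "0 < \<epsilon>" "\<epsilon> < 1 / 2" "0 < \<eta>" "\<eta> < 1 / 2"
  shows "pmf (label_dist \<epsilon> \<eta>) 1 = label_prob \<epsilon> \<eta>" "pmf (label_dist \<epsilon> \<eta>) 0 = 1 - label_prob \<epsilon> \<eta>"
proof -
  have inj: "inj (of_bool :: bool \<Rightarrow> real)" by (auto simp: inj_def of_bool_def split: if_splits)
  note p = label_prob_bounds[OF assms]
  show "pmf (label_dist \<epsilon> \<eta>) 1 = label_prob \<epsilon> \<eta>"
    using pmf_map_inj'[OF inj, of "bernoulli_pmf (label_prob \<epsilon> \<eta>)" True] p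
    by (simp add: label_dist_def label_prob_def)
  show "pmf (label_dist \<epsilon> \<eta>) 0 = 1 - label_prob \<epsilon> \<eta>"
    using pmf_map_inj'[OF inj, of "bernoulli_pmf (label_prob \<epsilon> \<eta>)" False] p
    by (simp add: label_dist_def label_prob_def)
qed

lemma set_D0: "set_pmf (D0 d \<epsilon> \<eta>) \<subseteq> sample_space d"
  by (auto simp: D0_def unif_def label_dist_def finite_cube cube_nonempty)

lemma expectation_D0:
  assumes "0 < \<epsilon>" "\<epsilon> < 1 / 2" "0 < \<eta>" "\<eta> < 1 / 2"
  shows "measure_pmf.expectation (D0 d \<epsilon> \<eta>) \<phi>
    = label_prob \<epsilon> \<eta> * cube_avg d (\<lambda>x. \<phi> (x, 1)) + (1 - label_prob \<epsilon> \<eta>) * cube_avg d (\<lambda>x. \<phi> (x, 0))"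
proof -
  have "measure_pmf.expectation (D0 d \<epsilon> \<eta>) \<phi> = (\<Sum>z\<in>sample_space d. \<phi> z * pmf (D0 d \<epsilon> \<eta>) z)"
    by (rule integral_measure_pmf_real) (use set_D0[of d \<epsilon> \<eta>] in \<open>auto simp: finite_cube\<close>)
  also have "\<dots> = (\<Sum>x\<in>cube d. \<Sum>y\<in>{0, 1}. \<phi> (x, y) * pmf (D0 d \<epsilon> \<eta>) (x, y))"
    by (simp only: sum.cartesian_product case_prod_unfold prod.collapse)
  also have "\<dots> = (\<Sum>x\<in>cube d. \<phi> (x, 0) * (1 - label_prob \<epsilon> \<eta>) / 2 ^ d + \<phi> (x, 1) * label_prob \<epsilon> \<eta> / 2 ^ d)"
    by (intro sum.cong refl) (simp add: D0_def pmf_pair pmf_unif pmf_label_dist[OF assms])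
  also have "\<dots> = label_prob \<epsilon> \<eta> * cube_avg d (\<lambda>x. \<phi> (x, 1)) + (1 - label_prob \<epsilon> \<eta>) * cube_avg d (\<lambda>x. \<phi> (x, 0))"
    by (simp add: cube_avg_def sum.distrib sum_distrib_left sum_divide_distrib mult.commute)
  finally show ?thesis .
qed

lemma expectation_unif: "measure_pmf.expectation (unif d) \<phi> = cube_avg d \<phi>"
  by (simp add: unif_def integral_pmf_of_set finite_cube cube_nonempty card_cube cube_avg_def)

lemma halfspace_conv_below: "halfspace d t v x = 1 - of_bool (dotp d v x < t)"
  by (simp add: halfspace_def)

lemma cube_avg_halfspace:
  "cube_avg d (halfspace d t v) = measure_pmf.prob (unif d) {x. halfspace d t v x > 0}"
proof -
  have "measure_pmf.prob (unif d) {x. halfspace d t v x > 0}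
     = measure_pmf.expectation (unif d) (indicator {x. halfspace d t v x > 0})"
    by simp
  also have "indicator {x. halfspace d t v x > 0} = halfspace d t v"
    by (auto simp: halfspace_def indicator_def)
  finally show ?thesis by (simp add: expectation_unif)
qed

lemma pmf_E_dist:
  "pmf (E_dist d \<epsilon> \<eta> t v) (x, y)
    = pmf (label_dist \<epsilon> \<eta>) y * pmf (if y = 1 then A_dist d \<eta> t v else B_dist d \<eta> t v) x"
proof -
  define D where "D y = (if y = 1 then A_dist d \<eta> t v else B_dist d \<eta> t v)" for y :: real
  have "pmf (map_pmf (\<lambda>x. (x, y')) (D y')) (x, y) = indicator {y} y' * pmf (D y) x" for y'
  proof (cases "y' = y")
    case True
    have "inj (\<lambda>x :: nat \<Rightarrow> real. (x, y))" by (auto simp: inj_def)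
    from pmf_map_inj'[OF this] show ?thesis using True by simp
  next
    case False
    then have "(x, y) \<notin> set_pmf (map_pmf (\<lambda>x. (x, y')) (D y'))" by auto
    then show ?thesis using False by (metis indicator_simps(2) mult_zero_left set_pmf_iff singletonD)
  qed
  then have "pmf (E_dist d \<epsilon> \<eta> t v) (x, y)
      = measure_pmf.expectation (label_dist \<epsilon> \<eta>) (\<lambda>y'. indicator {y} y' * pmf (D y) x)"
    by (simp add: E_dist_def pmf_bind flip: D_def)
  then show ?thesis by (simp add: D_def measure_pmf_single)
qed

lemma likelihood_ratio_eq:
  assumes par: "0 < \<epsilon>" "\<epsilon> < 1 / 2" "0 < \<eta>" "\<eta> < 1 / 2"
    and f: "cube_avg d (halfspace d t v) = 2 * \<epsilon>" and z: "z \<in> set_pmf (D0 d \<epsilon> \<eta>)"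
  shows "likelihood_ratio (E_dist d \<epsilon> \<eta> t v) (D0 d \<epsilon> \<eta>) z = 1 + centered_ratio d \<epsilon> \<eta> t v z"
proof -
  obtain x y where zxy: "z = (x, y)" "x \<in> cube d" "y = 0 \<or> y = 1"
    using z set_D0[of d \<epsilon> \<eta>] by (cases z) auto
  define p where "p = label_prob \<epsilon> \<eta>"
  note p = label_prob_bounds(3,4)[OF par, folded p_def]
  have u: "pmf (unif d) x > 0" using zxy by (simp add: pmf_unif)
  \<comment> \<open>With mean \<open>2 * \<epsilon>\<close>, the normalizing constants of the two
    mass functions are exactly the label probabilities \<open>p\<close> and
    \<open>1 - p\<close>.\<close>
  have A: "A_mass d \<eta> t v x = (\<eta> + (1 - 2 * \<eta>) * halfspace d t v x) / p * pmf (unif d) x"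
    by (simp add: A_mass_def expectation_unif f p_def label_prob_def algebra_simps)
  have B: "B_mass d \<eta> t v x = (1 - \<eta> - (1 - 2 * \<eta>) * halfspace d t v x) / (1 - p) * pmf (unif d) x"
    by (simp add: B_mass_def expectation_unif f p_def label_prob_def algebra_simps)
  have p_eq: "p = \<eta> + 2 * (1 - 2 * \<eta>) * \<epsilon>" by (simp add: p_def label_prob_def)
  show ?thesis
  proof (cases "y = 1")
    case True
    then have "likelihood_ratio (E_dist d \<epsilon> \<eta> t v) (D0 d \<epsilon> \<eta>) z = (\<eta> + (1 - 2 * \<eta>) * halfspace d t v x) / p"
      using u p by (simp add: zxy likelihood_ratio_def pmf_E_dist D0_def pmf_pair pmf_A_dist[OF par(3,4)] A
          pmf_label_dist[OF par] flip: p_def)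
    also have "\<dots> = 1 + (1 - 2 * \<eta>) * (halfspace d t v x - 2 * \<epsilon>) * (1 / p)"
      using p by (simp add: field_simps) (simp add: p_eq algebra_simps)
    finally show ?thesis using True by (simp add: centered_ratio_def zxy p_def)
  next
    case False
    then have "y = 0" using zxy by simp
    then have "likelihood_ratio (E_dist d \<epsilon> \<eta> t v) (D0 d \<epsilon> \<eta>) z = (1 - \<eta> - (1 - 2 * \<eta>) * halfspace d t v x) / (1 - p)"
      using u p by (simp add: zxy likelihood_ratio_def pmf_E_dist D0_def pmf_pair pmf_B_dist[OF par(3,4)] B
          pmf_label_dist[OF par] flip: p_def)
    also have "\<dots> = 1 + (1 - 2 * \<eta>) * (halfspace d t v x - 2 * \<epsilon>) * (- 1 / (1 - p))"
      using p by (simp add: field_simps) (simp add: p_eq algebra_simps)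
    finally show ?thesis using False by (simp add: centered_ratio_def zxy p_def)
  qed
qed

lemma cube_avg_cmult: "cube_avg d (\<lambda>x. c * \<phi> x) = c * cube_avg d \<phi>"
  by (simp add: cube_avg_def sum_distrib_left)

lemma cube_avg_mult_right: "cube_avg d (\<lambda>x. \<phi> x * c) = cube_avg d \<phi> * c"
  by (simp add: cube_avg_def sum_distrib_right)

lemma cube_avg_add: "cube_avg d (\<lambda>x. \<phi> x + \<psi> x) = cube_avg d \<phi> + cube_avg d \<psi>"
  by (simp add: cube_avg_def sum.distrib add_divide_distrib)

lemma cube_avg_diff: "cube_avg d (\<lambda>x. \<phi> x - \<psi> x) = cube_avg d \<phi> - cube_avg d \<psi>"
  by (simp add: cube_avg_def sum_subtractf diff_divide_distrib)

text \<open>The mean already vanishes conditionally on each label, because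
  \<open>halfspace - 2 * \<epsilon>\<close> averages to 0 over the cube.\<close>

lemma expectation_centered_ratio:
  assumes par: "0 < \<epsilon>" "\<epsilon> < 1 / 2" "0 < \<eta>" "\<eta> < 1 / 2"
    and f: "cube_avg d (halfspace d t v) = 2 * \<epsilon>"
  shows "measure_pmf.expectation (D0 d \<epsilon> \<eta>) (centered_ratio d \<epsilon> \<eta> t v) = 0"
proof -
  have 0: "cube_avg d (\<lambda>x. (1 - 2 * \<eta>) * (halfspace d t v x - 2 * \<epsilon>) * r) = 0" for r
    by (simp add: cube_avg_mult_right cube_avg_cmult cube_avg_diff cube_avg_const f)
  show ?thesis
    unfolding expectation_D0[OF par] centered_ratio_def fst_conv snd_conv 0 by simp
qed

text \<open>The labels contribute the factor \<open>1 / (p * (1 - p))\<close>, at most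
  \<open>2 / (\<epsilon> * \<delta>)\<close>, and the vectors contribute the covariance
  \<open>Q\<close> of two halfspaces, which carries a factor \<delta>. The two \<delta> cancel, so
  the bound does not degenerate as \<epsilon> approaches 1/2.\<close>

lemma ip_centered_ratio_bound:
  assumes par: "0 < \<epsilon>" "\<epsilon> < 1 / 2" "0 < \<eta>" "\<eta> < 1 / 2" and "0 < d"
    and v: "v \<in> cube d" "cube_avg d (halfspace d t v) = 2 * \<epsilon>"
    and u: "u \<in> cube d" "cube_avg d (halfspace d t u) = 2 * \<epsilon>"
  shows "\<bar>ip (D0 d \<epsilon> \<eta>) (centered_ratio d \<epsilon> \<eta> t v) (centered_ratio d \<epsilon> \<eta> t u)\<bar>
    \<le> 64 * (1 - 2 * \<eta>)\<^sup>2 / (\<epsilon> * real d) * (\<bar>dotp d v u\<bar> + sqrt (real d) + 2)"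
proof -
  define p where "p = label_prob \<epsilon> \<eta>"
  note p = label_prob_bounds[OF par, folded p_def]
  define \<delta> where "\<delta> = 1 - 2 * \<epsilon>"
  have \<delta>: "0 < \<delta>" using par by (simp add: \<delta>_def)
  define g where "g v x = (of_bool (dotp d v x < t) :: real)" for v x
  have f: "halfspace d t v x - 2 * \<epsilon> = \<delta> - g v x" for v x
    by (simp add: halfspace_conv_below \<delta>_def g_def)
  have g: "cube_avg d (g w) = \<delta>" if "cube_avg d (halfspace d t w) = 2 * \<epsilon>" for w
  proof -
    have "cube_avg d (\<lambda>x. halfspace d t w x - 2 * \<epsilon>) = 0"
      using that by (simp add: cube_avg_diff cube_avg_const)
    then show ?thesis unfolding f by (simp add: cube_avg_diff cube_avg_const)
  qed
  have walk: "walk_avg d (\<lambda>x. of_bool (x < t)) = \<delta>"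
    using cube_avg_dotp[OF v(1), of "\<lambda>x. of_bool (x < t)"] g[OF v(2)] by (simp add: g_def[abs_def])
  define Q where "Q = cube_avg d (\<lambda>x. (\<delta> - g v x) * (\<delta> - g u x))"
  have "Q = cube_avg d (\<lambda>x. (\<delta>\<^sup>2 - \<delta> * g v x - \<delta> * g u x) + g v x * g u x)"
    unfolding Q_def by (rule arg_cong[where f = "cube_avg d"]) (auto simp: power2_eq_square algebra_simps)
  also have "\<dots> = cube_avg d (\<lambda>x. g v x * g u x) - \<delta>\<^sup>2"
    using g[OF v(2)] g[OF u(2)]
    by (simp add: cube_avg_add cube_avg_diff cube_avg_cmult cube_avg_const power2_eq_square)
  finally have Q: "\<bar>Q\<bar> \<le> 32 * \<delta> / real d * (\<bar>dotp d v u\<bar> + sqrt (real d) + 2)"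
    using below_covariance_bound[OF \<open>0 < d\<close> v(1) u(1), of t] by (simp add: walk g_def)
  have "ip (D0 d \<epsilon> \<eta>) (centered_ratio d \<epsilon> \<eta> t v) (centered_ratio d \<epsilon> \<eta> t u)
     = p * cube_avg d (\<lambda>x. (1 - 2 * \<eta>)\<^sup>2 * (1 / p\<^sup>2) * ((\<delta> - g v x) * (\<delta> - g u x)))
     + (1 - p) * cube_avg d (\<lambda>x. (1 - 2 * \<eta>)\<^sup>2 * (1 / (1 - p)\<^sup>2) * ((\<delta> - g v x) * (\<delta> - g u x)))"
    unfolding ip_def expectation_D0[OF par] centered_ratio_def f p_def[symmetric]
    by (simp add: power2_eq_square mult_ac)
  also have "\<dots> = (1 - 2 * \<eta>)\<^sup>2 * (p * (1 / p\<^sup>2) + (1 - p) * (1 / (1 - p)\<^sup>2)) * Q"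
    unfolding cube_avg_cmult Q_def by (simp add: algebra_simps)
  also have "p * (1 / p\<^sup>2) + (1 - p) * (1 / (1 - p)\<^sup>2) = 1 / (p * (1 - p))"
    using p by (simp add: power2_eq_square divide_simps)
  finally have ip_eq: "ip (D0 d \<epsilon> \<eta>) (centered_ratio d \<epsilon> \<eta> t v) (centered_ratio d \<epsilon> \<eta> t u)
     = (1 - 2 * \<eta>)\<^sup>2 * (1 / (p * (1 - p))) * Q" .
  have "\<epsilon> * (\<delta> / 2) \<le> p * (1 - p)"
    using p par \<delta> by (intro mult_mono) (auto simp: \<delta>_def)
  then have inv: "1 / (p * (1 - p)) \<le> 1 / (\<epsilon> * (\<delta> / 2))"
    using par \<delta> p by (intro divide_left_mono) auto
  have "\<bar>ip (D0 d \<epsilon> \<eta>) (centered_ratio d \<epsilon> \<eta> t v) (centered_ratio d \<epsilon> \<eta> t u)\<bar>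
     = (1 - 2 * \<eta>)\<^sup>2 * (1 / (p * (1 - p))) * \<bar>Q\<bar>"
    unfolding ip_eq using p by (simp add: abs_mult)
  also have "\<dots> \<le> (1 - 2 * \<eta>)\<^sup>2 * (1 / (\<epsilon> * (\<delta> / 2)))
      * (32 * \<delta> / real d * (\<bar>dotp d v u\<bar> + sqrt (real d) + 2))"
    using inv Q par \<delta> p by (intro mult_mono) auto
  also have "\<dots> = 64 * (1 - 2 * \<eta>)\<^sup>2 / (\<epsilon> * real d) * (\<bar>dotp d v u\<bar> + sqrt (real d) + 2)"
    using \<delta> by simp
  finally show ?thesis .
qed


section \<open>Growth estimates and the constants\<close>

lemma exp_dominates_truncated_sum:
  assumes "0 < c" "0 < (C :: real)"
  shows "eventually (\<lambda>d :: nat. real d powr (real d powr (c / 4) + 1) \<le> 1 / 2 * 2 powr (C * real d powr c)) at_top"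
proof -
  \<comment> \<open>The logarithm of the claim: \<open>x powr (c / 4) * ln x\<close> is of lower
    order than \<open>x powr c\<close>.\<close>
  have "eventually (\<lambda>x :: real. (x powr (c / 4) + 1) * ln x + ln 2 \<le> C * x powr c * ln 2) at_top"
    using assms by real_asymp
  then have "eventually (\<lambda>x :: real. x powr (x powr (c / 4) + 1) \<le> 1 / 2 * 2 powr (C * x powr c)) at_top"
    using eventually_gt_at_top[of 0]
  proof eventually_elim
    case (elim x)
    then have "exp ((x powr (c / 4) + 1) * ln x + ln 2) \<le> exp (C * x powr c * ln 2)"
      by (simp only: exp_le_cancel_iff)
    then show ?case using elim by (simp add: powr_def exp_add mult_ac)
  qed
  then show ?thesis
    using filterlim_real_sequentially by (rule eventually_compose_filterlim)
qed

text \<open>The powers of \<open>d\<close> cancel because their exponents \<open>1/2 - c\<close> and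
  \<open>1/2 + c\<close> add up to 1, and \<open>\<epsilon>\<^sub>0 ^ 3\<close> absorbs one
  \<open>1/\<epsilon>\<close> from \<open>q\<close> and two from \<open>n\<close>. The scale
  \<open>M\<close> is 1 for distinct vectors and \<open>d\<close> on the diagonal.\<close>

lemma centered_ratio_n_bound:
  assumes par: "0 < \<epsilon>\<^sub>0" "\<epsilon>\<^sub>0 \<le> \<epsilon>" "0 < \<eta>" "\<eta> < 1 / 2" and "0 < d" "0 < c" "c < 1 / 2"
    and a: "0 < a" "a powr (1 / 2 - c) = \<epsilon>\<^sub>0 ^ 3 / 1024"
    and n: "real n \<le> (a * real d) powr (1 / 2 - c) / (\<epsilon>\<^sup>2 * (1 - 2 * \<eta>))"
    and q: "\<bar>q\<bar> \<le> 64 * (1 - 2 * \<eta>)\<^sup>2 / (\<epsilon> * real d) * (D + sqrt (real d) + 2)"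
    and D: "0 \<le> D" "D \<le> M * real d powr (1 / 2 + c)" "1 \<le> M"
  shows "\<bar>q\<bar> * real n \<le> M / 4"
proof -
  have "0 < \<epsilon>" using par by simp
  have d: "1 \<le> real d" using \<open>0 < d\<close> by simp
  have sq: "sqrt (real d) = real d powr (1 / 2)" by (simp add: powr_half_sqrt)
  have 1: "sqrt (real d) \<le> M * real d powr (1 / 2 + c)" "1 \<le> M * real d powr (1 / 2 + c)"
  proof -
    have "sqrt (real d) \<le> 1 * real d powr (1 / 2 + c)"
      unfolding sq using d \<open>0 < c\<close> by (simp add: powr_mono)
    also have "\<dots> \<le> M * real d powr (1 / 2 + c)" using D by (intro mult_right_mono) auto
    finally show *: "sqrt (real d) \<le> M * real d powr (1 / 2 + c)" .
    have "1 \<le> sqrt (real d)" using d by simp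
    with * show "1 \<le> M * real d powr (1 / 2 + c)" by linarith
  qed
  have d_powr: "real d powr (1 / 2 - c) * real d powr (1 / 2 + c) = real d"
    using d by (simp flip: powr_add)
  \<comment> \<open>The factor 4 counts \<open>D\<close>, \<open>sqrt d\<close> and the two units,
    each at most \<open>M * d powr (1/2 + c)\<close>; then
    \<open>64 * 4 / 1024 = 1/4\<close>.\<close>
  have "\<bar>q\<bar> \<le> 64 * (1 - 2 * \<eta>)\<^sup>2 / (\<epsilon> * real d) * (4 * (M * real d powr (1 / 2 + c)))"
    using q by (rule order_trans) (use par \<open>0 < \<epsilon>\<close> d 1 D in \<open>intro mult_left_mono; auto\<close>)
  then have "\<bar>q\<bar> * real n \<le> 64 * (1 - 2 * \<eta>)\<^sup>2 / (\<epsilon> * real d) * (4 * (M * real d powr (1 / 2 + c)))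
      * ((a * real d) powr (1 / 2 - c) / (\<epsilon>\<^sup>2 * (1 - 2 * \<eta>)))"
    by (intro mult_mono n) (use par \<open>0 < \<epsilon>\<close> d D in auto)
  also have "(a * real d) powr (1 / 2 - c) = \<epsilon>\<^sub>0 ^ 3 / 1024 * real d powr (1 / 2 - c)"
    using a d by (simp add: powr_mult)
  also have "64 * (1 - 2 * \<eta>)\<^sup>2 / (\<epsilon> * real d) * (4 * (M * real d powr (1 / 2 + c)))
      * (\<epsilon>\<^sub>0 ^ 3 / 1024 * real d powr (1 / 2 - c) / (\<epsilon>\<^sup>2 * (1 - 2 * \<eta>)))
    = M / 4 * ((1 - 2 * \<eta>) * (\<epsilon>\<^sub>0 ^ 3 / \<epsilon> ^ 3))
        * ((real d powr (1 / 2 - c) * real d powr (1 / 2 + c)) / real d)"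
    using par \<open>0 < \<epsilon>\<close> d by (simp add: field_simps power2_eq_square power3_eq_cube)
  also have "\<dots> = M / 4 * ((1 - 2 * \<eta>) * (\<epsilon>\<^sub>0 ^ 3 / \<epsilon> ^ 3))"
    unfolding d_powr using d by simp
  also have "\<dots> \<le> M / 4 * (1 * 1)"
    using par D \<open>0 < \<epsilon>\<close> by (intro mult_left_mono mult_mono) (auto simp: divide_le_eq_1 power_mono)
  finally show ?thesis by simp
qed

lemma sum_quarter_powers_le: "(\<Sum>j=1..m. (1 / 4 :: real) ^ j) \<le> 1 / 3"
proof -
  have "(\<Sum>j=1..m. (1 / 4 :: real) ^ j) = 1 / 3 - (1 / 4) ^ m / 3"
    by (induction m) auto
  then show ?thesis by simp
qed

lemma sum_powers_le:
  fixes x :: real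
  assumes "1 \<le> x"
  shows "(\<Sum>j=1..m. x ^ j) \<le> real m * x ^ m"
proof -
  have "(\<Sum>j=1..m. x ^ j) \<le> (\<Sum>j=1..m. x ^ m)"
    using assms by (intro sum_mono power_increasing) auto
  then show ?thesis by simp
qed

lemma double_sum_diag_le:
  fixes R :: "'a \<Rightarrow> 'a \<Rightarrow> real"
  assumes S: "finite S" and "\<And>v. v \<in> S \<Longrightarrow> R v v \<le> A"
    and "\<And>v u. v \<in> S \<Longrightarrow> u \<in> S \<Longrightarrow> v \<noteq> u \<Longrightarrow> R v u \<le> B" and "0 \<le> B"
  shows "(\<Sum>v\<in>S. \<Sum>u\<in>S. R v u) \<le> real (card S) * A + (real (card S))\<^sup>2 * B"
proof -
  have "(\<Sum>u\<in>S. R v u) \<le> A + real (card S) * B" if "v \<in> S" for v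
  proof -
    have "(\<Sum>u\<in>S. R v u) = R v v + (\<Sum>u\<in>S - {v}. R v u)"
      using S that by (rule sum.remove)
    also have "\<dots> \<le> A + (\<Sum>u\<in>S - {v}. B)"
      using assms that by (intro add_mono sum_mono) auto
    also have "\<dots> \<le> A + (\<Sum>u\<in>S. B)"
      using S \<open>0 \<le> B\<close> by (intro add_left_mono sum_mono2) auto
    finally show ?thesis by simp
  qed
  then have "(\<Sum>v\<in>S. \<Sum>u\<in>S. R v u) \<le> (\<Sum>v\<in>S. A + real (card S) * B)"
    by (rule sum_mono)
  then show ?thesis by (simp add: power2_eq_square distrib_left)
qed

section \<open>Choice of the constants and summation over diagonal and off-diagonal pairs\<close>

theorem theoremC6:
  "\<exists>d0 :: nat.
     \<forall>c \<in> {0<..<1/2 :: real}. \<forall>C > (0 :: real). \<forall>\<epsilon>\<^sub>0 \<in> {0<..<1/2 :: real}.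
     \<exists>a > (0 :: real). \<exists>b > (0 :: real).
     \<forall>(d :: nat) (\<epsilon> :: real) (\<eta> :: real) (t :: real) (S :: (nat \<Rightarrow> real) set) (n :: nat) (k :: nat).
       d > d0 \<and>
       \<epsilon>\<^sub>0 \<le> \<epsilon> \<and> \<epsilon> < 1/2 \<and>
       0 < \<eta> \<and> \<eta> < 1/2 \<and>
       (\<forall>v \<in> cube d. measure_pmf.prob (unif d) {x. halfspace d t v x > 0} = 2 * \<epsilon>) \<and>
       S \<subseteq> cube d \<and>
       real (card S) \<ge> 2 powr (C * real d powr c) \<and>
       (\<forall>u \<in> S. \<forall>v \<in> S. u \<noteq> v \<longrightarrow> \<bar>dotp d v u\<bar> < real d powr (1/2 + c)) \<and>
       real n \<le> (a * real d) powr (1/2 - c) / (\<epsilon>\<^sup>2 * (1 - 2 * \<eta>)) \<and>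
       even k \<and> real k < real d powr (c / 4)
       \<longrightarrow>
       (L2norm (iid_dist n (D0 d \<epsilon> \<eta>))
          (\<lambda>X. measure_pmf.expectation (pmf_of_set S)
                 (\<lambda>v. samplewise_proj d n (D0 d \<epsilon> \<eta>) \<infinity> (b * real k)
                        (tensor_power n (likelihood_ratio (E_dist d \<epsilon> \<eta> t v) (D0 d \<epsilon> \<eta>))) X)
               - 1))\<^sup>2 \<le> 1"
\<comment> \<open>The threshold 0 works because the small dimensions are handled by the choice of
  \<open>b\<close>.\<close>
proof (rule exI[of _ 0], intro ballI allI impI)
  fix c C \<epsilon>\<^sub>0 :: real
  assume c: "c \<in> {0<..<1/2}" and C: "C > 0" and \<epsilon>0: "\<epsilon>\<^sub>0 \<in> {0<..<1/2}"
  \<comment> \<open>Solves the equation for \<open>a\<close> required by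
    \<open>centered_ratio_n_bound\<close>; it depends only on \<open>c\<close> and
    \<open>\<epsilon>\<^sub>0\<close>.\<close>
  define a where "a = (\<epsilon>\<^sub>0 ^ 3 / 1024) powr (1 / (1 / 2 - c))"
  have a: "0 < a" "a powr (1 / 2 - c) = \<epsilon>\<^sub>0 ^ 3 / 1024"
    using \<epsilon>0 c by (auto simp: a_def powr_powr)
  obtain N :: nat where N: "\<And>d. d \<ge> N \<Longrightarrow>
      real d powr (real d powr (c / 4) + 1) \<le> 1 / 2 * 2 powr (C * real d powr c)"
    using exp_dominates_truncated_sum[of c C] c C unfolding eventually_at_top_linorder by auto
  \<comment> \<open>For \<open>d < N\<close>, \<open>k < d powr (c / 4) \<le> d\<close> forces
    \<open>b * k < 1\<close>, so no nonempty set is kept; for \<open>d \<ge> N\<close> only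
    \<open>b \<le> 1\<close> matters.\<close>
  define b where "b = 1 / (real N + 1)"
  have b: "0 < b" "b \<le> 1" by (auto simp: b_def)
  show "\<exists>a > (0 :: real). \<exists>b > (0 :: real).
     \<forall>(d :: nat) (\<epsilon> :: real) (\<eta> :: real) (t :: real) (S :: (nat \<Rightarrow> real) set) (n :: nat) (k :: nat).
       d > 0 \<and>
       \<epsilon>\<^sub>0 \<le> \<epsilon> \<and> \<epsilon> < 1/2 \<and>
       0 < \<eta> \<and> \<eta> < 1/2 \<and>
       (\<forall>v \<in> cube d. measure_pmf.prob (unif d) {x. halfspace d t v x > 0} = 2 * \<epsilon>) \<and>
       S \<subseteq> cube d \<and>
       real (card S) \<ge> 2 powr (C * real d powr c) \<and>
       (\<forall>u \<in> S. \<forall>v \<in> S. u \<noteq> v \<longrightarrow> \<bar>dotp d v u\<bar> < real d powr (1/2 + c)) \<and>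
       real n \<le> (a * real d) powr (1/2 - c) / (\<epsilon>\<^sup>2 * (1 - 2 * \<eta>)) \<and>
       even k \<and> real k < real d powr (c / 4)
       \<longrightarrow>
       (L2norm (iid_dist n (D0 d \<epsilon> \<eta>))
          (\<lambda>X. measure_pmf.expectation (pmf_of_set S)
                 (\<lambda>v. samplewise_proj d n (D0 d \<epsilon> \<eta>) \<infinity> (b * real k)
                        (tensor_power n (likelihood_ratio (E_dist d \<epsilon> \<eta> t v) (D0 d \<epsilon> \<eta>))) X)
               - 1))\<^sup>2 \<le> 1"
  proof (rule exI[of _ a], rule conjI[OF a(1)], rule exI[of _ b], rule conjI[OF b(1)],
      intro allI impI, elim conjE)
    fix d n k :: nat and \<epsilon> \<eta> t :: real and S :: "(nat \<Rightarrow> real) set"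
    assume d: "d > 0" and \<epsilon>: "\<epsilon>\<^sub>0 \<le> \<epsilon>" "\<epsilon> < 1/2" and \<eta>: "0 < \<eta>" "\<eta> < 1/2"
      and prob: "\<forall>v \<in> cube d. measure_pmf.prob (unif d) {x. halfspace d t v x > 0} = 2 * \<epsilon>"
      and S: "S \<subseteq> cube d" and card: "real (card S) \<ge> 2 powr (C * real d powr c)"
      and dot: "\<forall>u \<in> S. \<forall>v \<in> S. u \<noteq> v \<longrightarrow> \<bar>dotp d v u\<bar> < real d powr (1/2 + c)"
      and n: "real n \<le> (a * real d) powr (1/2 - c) / (\<epsilon>\<^sup>2 * (1 - 2 * \<eta>))"
      and k: "real k < real d powr (c / 4)"
    have d1: "1 \<le> real d" using d by simp
    have par: "0 < \<epsilon>" "\<epsilon> < 1 / 2" "0 < \<eta>" "\<eta> < 1 / 2" using \<epsilon> \<eta> \<epsilon>0 by auto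
    have cardS: "0 < real (card S)" using card by (rule less_le_trans[rotated]) simp
    have finS: "finite S" using S finite_cube finite_subset by blast
    have f: "cube_avg d (halfspace d t v) = 2 * \<epsilon>" if "v \<in> cube d" for v
      using prob that by (simp add: cube_avg_halfspace)
    define h where "h = centered_ratio d \<epsilon> \<eta> t"
    define m where "m = nat \<lfloor>b * real k\<rfloor>"
    define R where "R v u = (\<Sum>T | T \<subseteq> {..<n} \<and> T \<noteq> {} \<and> real (card T) \<le> b * real k.
        ip (D0 d \<epsilon> \<eta>) (h v) (h u) ^ card T)" for v u
    have bk: "0 \<le> b * real k" using b by simp
    have n_bound: "\<bar>ip (D0 d \<epsilon> \<eta>) (h v) (h u)\<bar> * real n \<le> M / 4"
      if "v \<in> S" "u \<in> S" "\<bar>dotp d v u\<bar> \<le> M * real d powr (1 / 2 + c)" "1 \<le> M" for v u M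
      using ip_centered_ratio_bound[OF par d, of v t u] that S f \<epsilon>0 c
      by (intro centered_ratio_n_bound[OF _ \<epsilon>(1) \<eta> d _ _ a n, of _ "\<bar>dotp d v u\<bar>"]) (auto simp: h_def)
    have R_off: "R v u \<le> 1 / 3" if "v \<in> S" "u \<in> S" "v \<noteq> u" for v u
    proof -
      have "\<bar>dotp d v u\<bar> \<le> 1 * real d powr (1 / 2 + c)" using dot that by force
      from sum_subsets_power_le[OF bk n_bound[OF that(1,2) this order_refl]]
      have "R v u \<le> (\<Sum>j=1..m. (1 / 4) ^ j)" by (simp add: R_def m_def)
      also have "\<dots> \<le> 1 / 3" by (rule sum_quarter_powers_le)
      finally show ?thesis .
    qed
    have R_diag: "R v v \<le> real m * real d ^ m" if "v \<in> S" for v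
    proof -
      have "dotp d v v = real d"
        using dotp_eq_disagreements[of v d v] S that by auto
      \<comment> \<open>A crude bound that fits the scale \<open>M = d\<close>; it costs only powers
        of \<open>d\<close>, which the size of \<open>S\<close> outweighs.\<close>
      also have "\<dots> \<le> real d * real d powr (1 / 2 + c)"
        using d1 c by (simp add: ge_one_powr_ge_zero)
      finally have "\<bar>dotp d v v\<bar> \<le> real d * real d powr (1 / 2 + c)"
        using \<open>dotp d v v = real d\<close> by simp
      from n_bound[OF that that this d1] have "\<bar>ip (D0 d \<epsilon> \<eta>) (h v) (h v)\<bar> * real n \<le> real d"
        using d1 by simp
      from sum_subsets_power_le[OF bk this]
      have "R v v \<le> (\<Sum>j=1..m. real d ^ j)" by (simp add: R_def m_def)
      also have "\<dots> \<le> real m * real d ^ m" by (rule sum_powers_le[OF d1])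
      finally show ?thesis .
    qed
    have diag: "real m * real d ^ m \<le> 1 / 2 * real (card S)"
    proof (cases "d \<ge> N")
      case True
      have "real m \<le> b * real k" using bk by (simp add: m_def)
      also have "\<dots> \<le> real k" using b by (simp add: mult_left_le_one_le)
      finally have m: "real m \<le> real d powr (c / 4)" using k by simp
      also have "\<dots> \<le> real d powr 1" using d1 c by (intro powr_mono) auto
      finally have m': "real m \<le> real d" using d1 by simp
      have "real m * real d ^ m \<le> real d * real d ^ m" using m' by (intro mult_right_mono) auto
      also have "\<dots> = real d powr (real m + 1)" using d1 by (simp add: powr_add powr_realpow)
      also have "\<dots> \<le> real d powr (real d powr (c / 4) + 1)"
        using m d1 by (intro powr_mono) auto
      also have "\<dots> \<le> 1 / 2 * 2 powr (C * real d powr c)" by (rule N[OF True])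
      also have "\<dots> \<le> 1 / 2 * real (card S)" using card by simp
      finally show ?thesis .
    next
      case False
      have "real k < real d powr 1"
        using k by (rule less_le_trans) (use d1 c in \<open>intro powr_mono; auto\<close>)
      then have "b * real k < 1" using False d1 by (simp add: b_def)
      then have "m = 0" using bk by (simp add: m_def)
      then show ?thesis by simp
    qed
    have "(L2norm (iid_dist n (D0 d \<epsilon> \<eta>))
          (\<lambda>X. measure_pmf.expectation (pmf_of_set S)
                 (\<lambda>v. samplewise_proj d n (D0 d \<epsilon> \<eta>) \<infinity> (b * real k)
                        (tensor_power n (likelihood_ratio (E_dist d \<epsilon> \<eta> t v) (D0 d \<epsilon> \<eta>))) X)
               - 1))\<^sup>2 = (\<Sum>v\<in>S. \<Sum>u\<in>S. R v u) / (real (card S))\<^sup>2"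
      unfolding R_def
    proof (rule L2norm_averaged_projection[OF set_D0 finS _ bk])
      show "S \<noteq> {}" using cardS by auto
    next
      fix v z assume "v \<in> S" "z \<in> set_pmf (D0 d \<epsilon> \<eta>)"
      then show "likelihood_ratio (E_dist d \<epsilon> \<eta> t v) (D0 d \<epsilon> \<eta>) z = 1 + h v z"
        using S f unfolding h_def by (intro likelihood_ratio_eq[OF par]) auto
    next
      fix v assume "v \<in> S"
      then show "measure_pmf.expectation (D0 d \<epsilon> \<eta>) (h v) = 0"
        using S f unfolding h_def by (intro expectation_centered_ratio[OF par]) auto
    qed
    \<comment> \<open>The diagonal contributes at most 1/2 and the off-diagonal pairs at most 1/3
      after normalization.\<close>
    also have "\<dots> \<le> (real (card S) * (1 / 2 * real (card S)) + (real (card S))\<^sup>2 * (1 / 3)) / (real (card S))\<^sup>2"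
      by (intro divide_right_mono double_sum_diag_le finS order_trans[OF R_diag diag] R_off) auto
    also have "\<dots> \<le> 1"
      using cardS by (simp add: divide_le_eq power2_eq_square)
    finally show "(L2norm (iid_dist n (D0 d \<epsilon> \<eta>))
          (\<lambda>X. measure_pmf.expectation (pmf_of_set S)
                 (\<lambda>v. samplewise_proj d n (D0 d \<epsilon> \<eta>) \<infinity> (b * real k)
                        (tensor_power n (likelihood_ratio (E_dist d \<epsilon> \<eta> t v) (D0 d \<epsilon> \<eta>))) X)
               - 1))\<^sup>2 \<le> 1" .
  qed
qed

end
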